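(* Let $(R,\mathfrak m)$ be a Noetherian local ring, let $J\subseteq R$ be an arbitrary ideal, and let $f_1,\ldots,f_r\in R$ be a $J$-filter regular sequence. Put $I=(f_1,\ldots,f_r)$ and, for $i=1,\ldots,r$, let $$a_i=a_J\!\left(\frac{(f_1,\ldots,f_{i-1}):f_i}{(f_1,\ldots,f_{i-1})}\right),\qquad A_i=\operatorname{ar}_J(f_1,\ldots,f_i).$$ Set $$N=\max\big\{a_1+a_2+2a_3+4a_4+\cdots+2^{r-2}a_r,\ A_1,\ldots,A_r\big\}+1.$$ Let $\varepsilon_1,\ldots,\varepsilon_r\in J^N$ be arbitrary, and put $f_i'=f_i+\varepsilon_i$ for $i=1,\ldots,r$ and $I'=(f_1',\ldots,f_r')$. Then: (i) $f_1',\ldots,f_r'$ is a $J$-filter regular sequence, and for $i=1,\ldots,r$ $$a_J\!\left(\frac{(f_1',\ldots,f_{i-1}'):f_i'}{(f_1',\ldots,f_{i-1}')}\right)\le 2^{i-1}a_i.$$ (ii) For $j=1,\ldots,r$, $\operatorname{in}(f_1',\ldots,f_j')=\operatorname{in}(f_1,\ldots,f_j)$. (iii) In particular, $\operatorname{gr}_J(R/I')\cong\operatorname{gr}_J(R/I)$ and $\operatorname{ar}_J(I')=\operatorname{ar}_J(I)$.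
   Context: Let $(R,\mathfrak m)$ be a Noetherian local ring and $J$ an ideal of $R$; $J^0=R$. $J$-Loewy length: for a finitely generated $R$-module $M$, $a_J(M)=\inf\{n\ge 0\mid J^nM=0\}$, with $a_J(M)=\infty$ if no such $n$ exists. A sequence $f_1,\ldots,f_r$ in $R$ is $J$-filter regular if for every $i=1,\ldots,r$ the element $f_i$ avoids every associated prime of $R/(f_1,\ldots,f_{i-1})$ not containing $J$; equivalently, $a_J\big(((f_1,\ldots,f_{i-1}):f_i)/(f_1,\ldots,f_{i-1})\big)<\infty$ for every $i$. For $i=1$ the ideal $(f_1,\ldots,f_{i-1})$ is $0$. Associated graded ring: $\operatorname{gr}_J(R/I)=\bigoplus_{n\ge 0}(J^n+I)/(J^{n+1}+I)$, the associated graded ring of $R/I$ with respect to $(J+I)/I$. Initial ideal: for an ideal $I\subseteq R$, $\operatorname{in}(I)=\bigoplus_{n\ge0}\big((I\cap J^n)+J^{n+1}\big)/J^{n+1}$, a homogeneous ideal of $\operatorname{gr}_J(R)=\bigoplus_{n\ge0}J^n/J^{n+1}$, so $\operatorname{gr}_J(R/I)\cong\operatorname{gr}_J(R)/\operatorname{in}(I)$. Write $\operatorname{in}(g_1,\ldots,g_s)$ for the initial ideal of the ideal $(g_1,\ldots,g_s)$. Artin--Rees number: $\operatorname{ar}_J(I)$ is the least integer $c\ge 0$ such that $J^{n+1}\cap I=J(J^n\cap I)$ for all $n\ge c$. Write $\operatorname{ar}_J(g_1,\ldots,g_s)$ for $\operatorname{ar}_J$ of the ideal $(g_1,\ldots,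g_s)$.
   Formalization: The ideal J is assumed proper (J ≠ R); for J = R the claim is false, since ε_1 = −f_1 lies in J^N = R and gives f_1' = 0, which is not J-filter regular in a nonzero ring. *)

theory Defs
  imports "HOL-Algebra.Algebra" "HOL-Library.Extended_Nat"
begin

locale noetherian_local_ring = cring R + noetherian_ring R for R (structure) +
  assumes unique_maximal: "\<exists>!M. maximalideal M R"

abbreviation ideal_pow :: "('a, 'b) ring_scheme \<Rightarrow> 'a set \<Rightarrow> nat \<Rightarrow> 'a set" where
  "ideal_pow R J n \<equiv> J [^]\<^bsub>ideals_set R\<^esub> n"

definition colon :: "('a, 'b) ring_scheme \<Rightarrow> 'a set \<Rightarrow> 'a \<Rightarrow> 'a set" where
  "colon R I x = {y \<in> carrier R. y \<otimes>\<^bsub>R\<^esub> x \<in> I}"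

text \<open>The ideal \<open>(f\<^sub>1, \<dots>, f\<^sub>i)\<close>; sequences are indexed from 1, and \<open>i = 0\<close> gives the zero ideal.\<close>

definition seq_ideal :: "('a, 'b) ring_scheme \<Rightarrow> (nat \<Rightarrow> 'a) \<Rightarrow> nat \<Rightarrow> 'a set" where
  "seq_ideal R f i = Idl\<^bsub>R\<^esub> (f ` {1..i})"

text \<open>The \<open>R\<close>-module \<open>K/I\<close> for ideals \<open>I \<subseteq> K\<close> of \<open>R\<close>, whose elements are cosets of \<open>I\<close>.
  Records of type \<^type>\<open>module\<close> extend rings; the ring multiplication and unit play no role
  in a module and are left unspecified.\<close>

definition subquot :: "('a, 'b) ring_scheme \<Rightarrow> 'a set \<Rightarrow> 'a set \<Rightarrow> ('a, 'a set) module" where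
  "subquot R K I =
    \<lparr>carrier = {I +>\<^bsub>R\<^esub> x | x. x \<in> K}, monoid.mult = undefined, one = undefined,
     ring.zero = I, ring.add = set_add R,
     smult = (\<lambda>r C. \<Union>x\<in>C. I +>\<^bsub>R\<^esub> (r \<otimes>\<^bsub>R\<^esub> x))\<rparr>"

text \<open>The submodule \<open>JM\<close>, in the style of \<^const>\<open>ideal_prod\<close>.\<close>

inductive_set ideal_smult ::
  "'a set \<Rightarrow> ('a, 'm, 'c) module_scheme \<Rightarrow> 'm set"
  for J and M where
    smult: "\<lbrakk>a \<in> J; x \<in> carrier M\<rbrakk> \<Longrightarrow> a \<odot>\<^bsub>M\<^esub> x \<in> ideal_smult J M"
  | sum: "\<lbrakk>s \<in> ideal_smult J M; t \<in> ideal_smult J M\<rbrakk> \<Longrightarrow> s \<oplus>\<^bsub>M\<^esub> t \<in> ideal_smult J M"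

definition loewy_length ::
  "('a, 'b) ring_scheme \<Rightarrow> 'a set \<Rightarrow> ('a, 'm, 'c) module_scheme \<Rightarrow> enat" where
  "loewy_length R J M = Inf (enat ` {n. ideal_smult (ideal_pow R J n) M = {\<zero>\<^bsub>M\<^esub>}})"

definition associated_primes ::
  "('a, 'b) ring_scheme \<Rightarrow> ('a, 'm, 'c) module_scheme \<Rightarrow> 'a set set" where
  "associated_primes R M =
    {P. primeideal P R \<and> (\<exists>x\<in>carrier M. P = {r \<in> carrier R. r \<odot>\<^bsub>M\<^esub> x = \<zero>\<^bsub>M\<^esub>})}"

definition filter_regular ::
  "('a, 'b) ring_scheme \<Rightarrow> 'a set \<Rightarrow> (nat \<Rightarrow> 'a) \<Rightarrow> nat \<Rightarrow> bool" where
  "filter_regular R J f r \<longleftrightarrow>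
    (\<forall>i\<in>{1..r}. f i \<in> carrier R \<and>
      (\<forall>P\<in>associated_primes R (subquot R (carrier R) (seq_ideal R f (i - 1))).
        \<not> J \<subseteq> P \<longrightarrow> f i \<notin> P))"

text \<open>The module \<open>((f\<^sub>1, \<dots>, f\<^sub>i\<^sub>-\<^sub>1) : f\<^sub>i) / (f\<^sub>1, \<dots>, f\<^sub>i\<^sub>-\<^sub>1)\<close>.\<close>

definition colon_quot ::
  "('a, 'b) ring_scheme \<Rightarrow> (nat \<Rightarrow> 'a) \<Rightarrow> nat \<Rightarrow> ('a, 'a set) module" where
  "colon_quot R f i =
    subquot R (colon R (seq_ideal R f (i - 1)) (f i)) (seq_ideal R f (i - 1))"

text \<open>By the Artin-Rees lemma the set below is nonempty when \<open>R\<close> is Noetherian.\<close>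

definition artin_rees_number :: "('a, 'b) ring_scheme \<Rightarrow> 'a set \<Rightarrow> 'a set \<Rightarrow> enat" where
  "artin_rees_number R J I =
    Inf (enat ` {c. \<forall>n\<ge>c. ideal_pow R J (Suc n) \<inter> I = ideal_prod R J (ideal_pow R J n \<inter> I)})"

text \<open>The direct sum of a sequence of modules: finitely supported families.\<close>

definition direct_sum :: "(nat \<Rightarrow> ('a, 'm, 'c) module_scheme) \<Rightarrow> (nat \<Rightarrow> 'm) set" where
  "direct_sum M = {s. (\<forall>n. s n \<in> carrier (M n)) \<and> finite {n. s n \<noteq> \<zero>\<^bsub>M n\<^esub>}}"

text \<open>The associated graded ring \<open>\<Oplus>\<^sub>n F\<^sub>n/F\<^sub>n\<^sub>+\<^sub>1\<close> of a decreasing filtration of \<open>R\<close> by ideals with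
  \<open>F\<^sub>0 = R\<close> and \<open>F\<^sub>i F\<^sub>j \<subseteq> F\<^sub>i\<^sub>+\<^sub>j\<close>. The product of the classes of \<open>x \<in> F\<^sub>i\<close> and \<open>y \<in> F\<^sub>j\<close> is the
  class of \<open>xy\<close> in \<open>F\<^sub>i\<^sub>+\<^sub>j/F\<^sub>i\<^sub>+\<^sub>j\<^sub>+\<^sub>1\<close>.\<close>

definition gr_comp :: "('a, 'b) ring_scheme \<Rightarrow> (nat \<Rightarrow> 'a set) \<Rightarrow> nat \<Rightarrow> ('a, 'a set) module" where
  "gr_comp R F n = subquot R (F n) (F (Suc n))"

definition gr_ring :: "('a, 'b) ring_scheme \<Rightarrow> (nat \<Rightarrow> 'a set) \<Rightarrow> (nat \<Rightarrow> 'a set) ring" where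
  "gr_ring R F =
    \<lparr>carrier = direct_sum (gr_comp R F),
     monoid.mult = (\<lambda>s t n. \<Oplus>\<^bsub>gr_comp R F n\<^esub>i\<in>{..n}. rcoset_mult R (F (Suc n)) (s i) (t (n - i))),
     one = (\<lambda>n. if n = 0 then F 1 +>\<^bsub>R\<^esub> \<one>\<^bsub>R\<^esub> else F (Suc n)),
     ring.zero = (\<lambda>n. F (Suc n)),
     ring.add = (\<lambda>s t n. s n <+>\<^bsub>R\<^esub> t n)\<rparr>"

definition gr_homogeneous ::
  "('a, 'b) ring_scheme \<Rightarrow> (nat \<Rightarrow> 'a set) \<Rightarrow> nat \<Rightarrow> (nat \<Rightarrow> 'a set) set" where
  "gr_homogeneous R F n = {s \<in> carrier (gr_ring R F). \<forall>m. m \<noteq> n \<longrightarrow> s m = F (Suc m)}"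

text \<open>Isomorphism of graded rings.\<close>

definition gr_isomorphic ::
  "('a, 'b) ring_scheme \<Rightarrow> (nat \<Rightarrow> 'a set) \<Rightarrow> (nat \<Rightarrow> 'a set) \<Rightarrow> bool" where
  "gr_isomorphic R F G \<longleftrightarrow>
    (\<exists>h \<in> ring_iso (gr_ring R F) (gr_ring R G).
      \<forall>n. h ` gr_homogeneous R F n = gr_homogeneous R G n)"

text \<open>The filtration \<open>J\<^sup>n + I\<close>, whose associated graded ring is \<open>gr\<^sub>J(R/I)\<close>.\<close>

definition adic_filtration ::
  "('a, 'b) ring_scheme \<Rightarrow> 'a set \<Rightarrow> 'a set \<Rightarrow> nat \<Rightarrow> 'a set" where
  "adic_filtration R J I n = ideal_pow R J n <+>\<^bsub>R\<^esub> I"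

text \<open>The initial ideal \<open>in(I)\<close>, as a subset of \<open>gr\<^sub>J(R)\<close>, that is of
  \<open>carrier (gr_ring R (ideal_pow R J))\<close>.\<close>

definition initial_ideal ::
  "('a, 'b) ring_scheme \<Rightarrow> 'a set \<Rightarrow> 'a set \<Rightarrow> (nat \<Rightarrow> 'a set) set" where
  "initial_ideal R J I =
    direct_sum (\<lambda>n. subquot R ((I \<inter> ideal_pow R J n) <+>\<^bsub>R\<^esub> ideal_pow R J (Suc n))
                              (ideal_pow R J (Suc n)))"

end

theory Submission
  imports Defs
begin

text \<open>Perturb one element \<open>f\<close> modulo an ideal \<open>L\<close> at a time, with \<open>\<epsilon> \<in> J\<^sup>N\<close>. If \<open>x \<equiv> y (f + \<epsilon>)\<close> modulo
  \<open>L\<close> lies in \<open>J\<^sup>n\<close>, then \<open>x - \<epsilon> y \<in> (L, f)\<close>, and since \<open>N\<close> exceeds the Artin-Rees number of \<open>(L, f)\<close> while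
  \<open>\<epsilon> (L : f) \<subseteq> L\<close>, the order of \<open>y\<close> modulo \<open>L : f\<close> can be raised step by step. This shows that \<open>(L, f)\<close> and
  \<open>(L, f + \<epsilon>)\<close> have the same initial ideal and, by Krull's intersection theorem, that
  \<open>L : (f + \<epsilon>) \<subseteq> L : f\<close>. A similar descent shows that \<open>J\<^sup>a ((L, f) : g) \<subseteq> (L, f)\<close> implies
  \<open>J\<^sup>2\<^sup>a ((L, f + \<epsilon>) : g) \<subseteq> (L, f + \<epsilon>)\<close>. Perturbing the sequence from its last element to its first
  doubles the \<open>i\<close>-th exponent \<open>i - 1\<close> times, and the perturbation of \<open>f\<^sub>1\<close> is the step that requires
  \<open>N \<ge> a\<^sub>1 + a\<^sub>2 + 2 a\<^sub>3 + \<dots> + 2\<^sup>r\<^sup>-\<^sup>2 a\<^sub>r\<close>. The initial ideal determines the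
  Artin-Rees number and the associated graded ring.\<close>

section \<open>Ideals and their powers\<close>

text \<open>The perturbed entry \<open>f\<close> need not come last: the descent for
  \<open>(L, f)\<close> needs \<open>\<epsilon> (L : f) \<subseteq> L\<close> also when
  \<open>L\<close> contains entries that follow \<open>f\<close>. Carrying \<open>f\<close> past a
  later \<open>g\<close> turns an exponent \<open>b\<close> for \<open>(L : f) / L\<close> and an
  exponent \<open>a\<close> for \<open>((L, f) : g) / (L, f)\<close> into the exponent
  \<open>b + a\<close> for \<open>((L, g) : f) / (L, g)\<close>. Carrying the \<open>k\<close>-th
  entry to the end thus costs the sum of the current exponents from \<open>k\<close> on. For
  \<open>k = 1\<close> these are \<open>a_1, a_2, 2 a_3, ..., 2^(r-2) a_r\<close>, whence the sum in
  \<open>N\<close>; in the opposite order the last step alone would ask for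
  \<open>2^(r-1) a_r\<close>. The doubling arises as follows. One factor \<open>J^a\<close> sends an
  element of \<open>L : g\<close> into \<open>(L, f)\<close>. Replacing \<open>f\<close> by
  \<open>f + \<epsilon>\<close> leaves an error divisible by \<open>\<epsilon>\<close>, and the
  second factor \<open>J^a\<close>, joined with a factor \<open>J^a\<close> split off from
  \<open>\<epsilon>\<close>, restores \<open>J^(2a)\<close> for the next round. The Artin-Rees
  numbers of the original ideals serve at every stage, because each stage keeps the initial
  ideals.\<close>

context ring
begin

lemma ideal_add: "\<lbrakk>ideal I R; x \<in> I; y \<in> I\<rbrakk> \<Longrightarrow> x \<oplus> y \<in> I"
  by (simp add: additive_subgroup.a_closed ideal.axioms(1))

lemma ideal_lmult: "\<lbrakk>ideal I R; x \<in> I; r \<in> carrier R\<rbrakk> \<Longrightarrow> r \<otimes> x \<in> I"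
  by (simp add: ideal.I_l_closed)

lemma ideal_rmult: "\<lbrakk>ideal I R; x \<in> I; r \<in> carrier R\<rbrakk> \<Longrightarrow> x \<otimes> r \<in> I"
  by (simp add: ideal.I_r_closed)

lemma ideal_neg: "\<lbrakk>ideal I R; x \<in> I\<rbrakk> \<Longrightarrow> \<ominus> x \<in> I"
  by (simp add: additive_subgroup.a_inv_closed ideal.axioms(1))

lemma ideal_diff: "\<lbrakk>ideal I R; x \<in> I; y \<in> I\<rbrakk> \<Longrightarrow> x \<ominus> y \<in> I"
  by (simp add: a_minus_def ideal_add ideal_neg)

lemma ideal_zero: "ideal I R \<Longrightarrow> \<zero> \<in> I"
  by (simp add: additive_subgroup.zero_closed ideal.axioms(1))

lemma ideal_subset: "ideal I R \<Longrightarrow> I \<subseteq> carrier R"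
  by (simp add: additive_subgroup.a_subset ideal.axioms(1))

lemma set_add_mem_iff:
  "z \<in> A <+> B \<longleftrightarrow> (\<exists>a\<in>A. \<exists>b\<in>B. z = a \<oplus> b)"
  by (auto simp: set_add_def')

lemma subset_set_add1: "\<lbrakk>ideal I R; ideal K R\<rbrakk> \<Longrightarrow> I \<subseteq> I <+> K"
  by (metis genideal_self ideal_subset le_sup_iff union_genideal Un_subset_iff)

lemma subset_set_add2: "\<lbrakk>ideal I R; ideal K R\<rbrakk> \<Longrightarrow> K \<subseteq> I <+> K"
  by (metis genideal_self ideal_subset le_sup_iff union_genideal Un_subset_iff)

lemma set_add_minimal: "\<lbrakk>ideal M R; I \<subseteq> M; K \<subseteq> M\<rbrakk> \<Longrightarrow> I <+> K \<subseteq> M"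
  by (auto simp: set_add_mem_iff intro!: ideal_add)

lemma ideal_prod_minimal:
  "\<lbrakk>ideal M R; \<And>i j. i \<in> I \<Longrightarrow> j \<in> K \<Longrightarrow> i \<otimes> j \<in> M\<rbrakk> \<Longrightarrow> I \<cdot> K \<subseteq> M"
proof
  fix s assume "ideal M R" and ij: "\<And>i j. i \<in> I \<Longrightarrow> j \<in> K \<Longrightarrow> i \<otimes> j \<in> M" and "s \<in> I \<cdot> K"
  from this(3) show "s \<in> M"
    by induct (auto intro: ij ideal_add[OF \<open>ideal M R\<close>])
qed

lemma ideal_prod_mono: "\<lbrakk>I \<subseteq> I'; K \<subseteq> K'\<rbrakk> \<Longrightarrow> I \<cdot> K \<subseteq> I' \<cdot> K'"
proof
  fix s assume I: "I \<subseteq> I'" "K \<subseteq> K'" and "s \<in> I \<cdot> K"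
  from this(3) show "s \<in> I' \<cdot> K'"
    by induct (use I in \<open>auto intro: ideal_prod.intros\<close>)
qed

end

context cring
begin

lemma ideal_pow_ideal: "ideal J R \<Longrightarrow> ideal (ideal_pow R J n) R"
  by (induct n) (auto simp: ideals_set_def oneideal ideal_prod_is_ideal)

lemma ideal_pow_0: "ideal_pow R J 0 = carrier R"
  by (simp add: ideals_set_def)

lemma ideal_pow_Suc: "ideal_pow R J (Suc n) = ideal_pow R J n \<cdot> J"
  by (simp add: ideals_set_def)

lemma ideal_pow_Suc2: "ideal J R \<Longrightarrow> ideal_pow R J (Suc n) = J \<cdot> ideal_pow R J n"
  by (simp only: ideal_pow_Suc ideal_prod_commute ideal_pow_ideal)

lemma ideal_pow_1: "ideal J R \<Longrightarrow> ideal_pow R J (Suc 0) = J"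
  by (metis ideal_pow_0 ideal_pow_Suc2 ideal_prod_one)

lemma ideal_pow_add:
  "ideal J R \<Longrightarrow> ideal_pow R J (m + n) = ideal_pow R J m \<cdot> ideal_pow R J n"
proof (induct n)
  case 0
  then show ?case by (simp only: add_0_right ideal_pow_0 ideal_prod_one ideal_pow_ideal)
next
  case (Suc n)
  then show ?case
    by (simp only: add_Suc_right ideal_pow_Suc ideal_prod_assoc ideal_pow_ideal)
qed

lemma ideal_pow_mult_mem:
  "\<lbrakk>ideal J R; x \<in> ideal_pow R J m; y \<in> ideal_pow R J n\<rbrakk> \<Longrightarrow> x \<otimes> y \<in> ideal_pow R J (m + n)"
  by (simp add: ideal_pow_add ideal_prod.prod)

lemma ideal_pow_antimono:
  assumes "ideal J R" "m \<le> n" shows "ideal_pow R J n \<subseteq> ideal_pow R J m"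
proof -
  obtain k where "n = m + k" using assms(2) le_Suc_ex by blast
  then show ?thesis
    using ideal_prod_inter[OF ideal_pow_ideal ideal_pow_ideal, OF assms(1,1), of m k]
    by (simp add: ideal_pow_add assms)
qed

lemma ideal_pow_mult_mem_le:
  "\<lbrakk>ideal J R; x \<in> ideal_pow R J m; y \<in> ideal_pow R J n; k \<le> m + n\<rbrakk>
    \<Longrightarrow> x \<otimes> y \<in> ideal_pow R J k"
  using ideal_pow_antimono ideal_pow_mult_mem by blast

text \<open>An ideal product consists of sums of products; with a principal factor each sum
  collapses into one product, so a single coefficient can be extracted.\<close>

lemma cgenideal_prod_iff:
  assumes a: "a \<in> carrier R" and I: "ideal I R"
  shows "z \<in> (PIdl a) \<cdot> I \<longleftrightarrow> (\<exists>b\<in>I. z = a \<otimes> b)"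
proof
  assume "z \<in> (PIdl a) \<cdot> I"
  then show "\<exists>b\<in>I. z = a \<otimes> b"
  proof induct
    case (prod i j)
    then obtain r where r: "r \<in> carrier R" "i = r \<otimes> a" by (auto simp: cgenideal_def)
    have "j \<in> carrier R" using prod I ideal_subset by blast
    then have "i \<otimes> j = a \<otimes> (r \<otimes> j)" using r a by algebra
    moreover have "r \<otimes> j \<in> I" using prod r I ideal_lmult by blast
    ultimately show ?case by blast
  next
    case (sum s t)
    then obtain b c where "b \<in> I" "c \<in> I" "s = a \<otimes> b" "t = a \<otimes> c" by blast
    then show ?case
      using I a by (intro bexI[of _ "b \<oplus> c"]) (auto simp: r_distr ideal.Icarr ideal_add)
  qed
next
  assume "\<exists>b\<in>I. z = a \<otimes> b"
  then show "z \<in> (PIdl a) \<cdot> I" using a by (auto intro: ideal_prod.prod cgenideal_self)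
qed

section \<open>Ideals with one more generator, and colon ideals\<close>

definition adjoin :: "'a set \<Rightarrow> 'a \<Rightarrow> 'a set" where
  "adjoin L f = L <+> PIdl f"

lemma adjoin_ideal: "\<lbrakk>ideal L R; f \<in> carrier R\<rbrakk> \<Longrightarrow> ideal (adjoin L f) R"
  by (simp add: adjoin_def add_ideals cgenideal_ideal)

text \<open>Membership becomes a congruence \<open>x = z f\<close> modulo \<open>L\<close>. The
  later arguments then reduce to ring identities between elements of \<open>L\<close>.\<close>

lemma adjoin_iff:
  assumes L: "ideal L R" and f: "f \<in> carrier R"
  shows "x \<in> adjoin L f \<longleftrightarrow> x \<in> carrier R \<and> (\<exists>z\<in>carrier R. x \<ominus> z \<otimes> f \<in> L)"
proof
  assume "x \<in> adjoin L f"
  then obtain l z where l: "l \<in> L" "z \<in> carrier R" "x = l \<oplus> z \<otimes> f"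
    by (auto simp: adjoin_def set_add_mem_iff cgenideal_def)
  moreover have lc: "l \<in> carrier R" using l L ideal_subset by blast
  moreover have "x \<ominus> z \<otimes> f = l" unfolding l(3) using lc l(2) f by algebra
  ultimately show "x \<in> carrier R \<and> (\<exists>z\<in>carrier R. x \<ominus> z \<otimes> f \<in> L)" using f by (auto intro!: bexI[of _ z])
next
  assume "x \<in> carrier R \<and> (\<exists>z\<in>carrier R. x \<ominus> z \<otimes> f \<in> L)"
  then obtain z where z: "x \<in> carrier R" "z \<in> carrier R" "x \<ominus> z \<otimes> f \<in> L" by blast
  have "x = (x \<ominus> z \<otimes> f) \<oplus> z \<otimes> f" using z(1,2) f by algebra
  then show "x \<in> adjoin L f"
    using z by (auto simp: adjoin_def set_add_mem_iff cgenideal_def)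
qed

lemma adjoinI:
  "\<lbrakk>ideal L R; f \<in> carrier R; x \<in> carrier R; z \<in> carrier R; x \<ominus> z \<otimes> f \<in> L\<rbrakk> \<Longrightarrow> x \<in> adjoin L f"
  by (auto simp: adjoin_iff)

lemma adjoinE:
  assumes "ideal L R" "f \<in> carrier R" "x \<in> adjoin L f"
  obtains z where "z \<in> carrier R" "x \<ominus> z \<otimes> f \<in> L"
  using assms by (auto simp: adjoin_iff)

lemma adjoin_subset: "\<lbrakk>ideal L R; f \<in> carrier R\<rbrakk> \<Longrightarrow> L \<subseteq> adjoin L f"
  unfolding adjoin_def by (simp add: subset_set_add1 cgenideal_ideal)

lemma adjoin_self: "\<lbrakk>ideal L R; f \<in> carrier R\<rbrakk> \<Longrightarrow> f \<in> adjoin L f"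
  unfolding adjoin_def using subset_set_add2[OF _ cgenideal_ideal] cgenideal_self by blast

lemma adjoin_minimal:
  assumes "ideal M R" "L \<subseteq> M" "f \<in> M" shows "adjoin L f \<subseteq> M"
  unfolding adjoin_def using assms by (simp add: set_add_minimal cgenideal_minimal)

lemma Idl_insert:
  assumes "S \<subseteq> carrier R" "f \<in> carrier R" shows "Idl (insert f S) = adjoin (Idl S) f"
proof
  have i: "ideal (Idl S) R" and S: "S \<subseteq> Idl S"
    using assms by (simp_all add: genideal_ideal genideal_self)
  show "Idl (insert f S) \<subseteq> adjoin (Idl S) f"
    using adjoin_subset[OF i assms(2)] adjoin_self[OF i assms(2)] S
    by (intro genideal_minimal adjoin_ideal i assms) auto
  have "ideal (Idl (insert f S)) R" and "insert f S \<subseteq> Idl (insert f S)"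
    using assms genideal_ideal[of "insert f S"] genideal_self[of "insert f S"] by simp_all
  then show "adjoin (Idl S) f \<subseteq> Idl (insert f S)"
    by (intro adjoin_minimal genideal_minimal) auto
qed

text \<open>Since \<open>P (L + (f)) = P L + f P\<close>, the coefficient of \<open>f\<close> can be
  taken in \<open>P\<close>. With \<open>P\<close> a power of \<open>J\<close>, this converts an
  Artin-Rees estimate for \<open>x\<close> into an order for its coefficient.\<close>

lemma adjoin_prod_mem:
  assumes L: "ideal L R" and f: "f \<in> carrier R" and P: "ideal P R" and x: "x \<in> P \<cdot> adjoin L f"
  obtains z where "z \<in> P" "x \<ominus> z \<otimes> f \<in> L"
proof -
  have *: "ideal (PIdl f) R" using f by (rule cgenideal_ideal)
  have "P \<cdot> adjoin L f = P \<cdot> L <+> (PIdl f) \<cdot> P"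
    unfolding adjoin_def by (simp add: ideal_prod_distr P L * ideal_prod_commute[OF * P])
  then obtain l z where lz: "l \<in> P \<cdot> L" "z \<in> P" "x = l \<oplus> f \<otimes> z"
    using x by (auto simp: set_add_mem_iff cgenideal_prod_iff[OF f P])
  have "l \<in> L" using lz(1) ideal_prod_inter[OF P L] by blast
  moreover have "l \<in> carrier R" "z \<in> carrier R" using \<open>l \<in> L\<close> lz L P ideal_subset by blast+
  then have "x \<ominus> z \<otimes> f = l" unfolding lz(3) using f by algebra
  ultimately show ?thesis using that lz by simp
qed

lemma colon_iff: "y \<in> colon R L f \<longleftrightarrow> y \<in> carrier R \<and> y \<otimes> f \<in> L"
  by (simp add: colon_def)

lemma colon_ideal: "\<lbrakk>ideal L R; f \<in> carrier R\<rbrakk> \<Longrightarrow> ideal (colon R L f) R"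
  using ideal.helper_max_prime[OF _ cring_axioms, of L f]
  by (simp add: colon_def m_comm cong: conj_cong)

end

section \<open>The Artin-Rees lemma\<close>

text \<open>A homogeneous ideal of the Rees algebra, the direct sum of the \<open>J^n\<close>, given
  by its components. Finite generation of that ideal appears as
  \<open>H (Suc n) \<subseteq> J \<cdot> H n\<close> for large \<open>n\<close>.\<close>

definition rees_submodule :: "('a, 'b) ring_scheme \<Rightarrow> 'a set \<Rightarrow> (nat \<Rightarrow> 'a set) \<Rightarrow> bool" where
  "rees_submodule R J H \<longleftrightarrow>
    (\<forall>n. ideal (H n) R \<and> H n \<subseteq> ideal_pow R J n \<and> J \<cdot>\<^bsub>R\<^esub> H n \<subseteq> H (Suc n))"

text \<open>The part of degree \<open>n\<close> and of degree less than \<open>i\<close> in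
  \<open>x\<close>, where elements of \<open>Q\<close> and \<open>x\<close> both have degree 1.
  Subtraction truncates, so this reading is valid for \<open>i \<le> Suc n\<close>.\<close>

primrec lower_terms :: "('a, 'b) ring_scheme \<Rightarrow> 'a set \<Rightarrow> 'a \<Rightarrow> nat \<Rightarrow> nat \<Rightarrow> 'a set" where
  "lower_terms R Q x n 0 = {\<zero>\<^bsub>R\<^esub>}"
| "lower_terms R Q x n (Suc i) =
    lower_terms R Q x n i <+>\<^bsub>R\<^esub> (PIdl\<^bsub>R\<^esub> (x [^]\<^bsub>R\<^esub> i)) \<cdot>\<^bsub>R\<^esub> ideal_pow R Q (n - i)"

text \<open>The leading coefficients of Hilbert's basis theorem, with respect to \<open>x\<close>.
  Indexing by the degree \<open>k\<close> of the coefficient, rather than by the total degree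
  \<open>k + i\<close>, makes each row (fixed \<open>i\<close>) a homogeneous ideal of the Rees
  algebra of \<open>Q\<close>.\<close>

definition leading_ideal ::
  "('a, 'b) ring_scheme \<Rightarrow> 'a set \<Rightarrow> 'a \<Rightarrow> (nat \<Rightarrow> 'a set) \<Rightarrow> nat \<Rightarrow> nat \<Rightarrow> 'a set" where
  "leading_ideal R Q x H i k =
    {b \<in> ideal_pow R Q k. \<exists>h\<in>H (k + i). h \<ominus>\<^bsub>R\<^esub> x [^]\<^bsub>R\<^esub> i \<otimes>\<^bsub>R\<^esub> b \<in> lower_terms R Q x (k + i) i}"

context cring
begin

lemma lower_terms_ideal:
  "\<lbrakk>ideal Q R; x \<in> carrier R\<rbrakk> \<Longrightarrow> ideal (lower_terms R Q x n i) R"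
  by (induct i)
    (auto intro!: zeroideal add_ideals ideal_prod_is_ideal cgenideal_ideal ideal_pow_ideal)

lemma lower_terms_Suc_iff:
  assumes "ideal Q R" "x \<in> carrier R"
  shows "v \<in> lower_terms R Q x n (Suc i) \<longleftrightarrow>
    (\<exists>w\<in>lower_terms R Q x n i. \<exists>b\<in>ideal_pow R Q (n - i). v = w \<oplus> x [^] i \<otimes> b)"
proof -
  have "x [^] i \<in> carrier R" "ideal (ideal_pow R Q (n - i)) R"
    using assms ideal_pow_ideal by auto
  note * = cgenideal_prod_iff[OF this]
  show ?thesis unfolding lower_terms.simps set_add_mem_iff Bex_def * by blast
qed

lemma lower_terms_subset_Suc:
  "\<lbrakk>ideal Q R; x \<in> carrier R\<rbrakk> \<Longrightarrow> lower_terms R Q x n i \<subseteq> lower_terms R Q x n (Suc i)"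
  by (simp add: subset_set_add1 lower_terms_ideal ideal_prod_is_ideal cgenideal_ideal ideal_pow_ideal)

lemma lower_terms_mult:
  assumes Q: "ideal Q R" and x: "x \<in> carrier R" and d: "d \<in> Q"
  shows "\<lbrakk>v \<in> lower_terms R Q x n i; i \<le> Suc n\<rbrakk> \<Longrightarrow> d \<otimes> v \<in> lower_terms R Q x (Suc n) i"
proof (induct i arbitrary: v)
  case 0
  then show ?case using ideal.Icarr[OF Q d] by simp
next
  case (Suc i)
  from Suc.prems(1) obtain w b where w: "w \<in> lower_terms R Q x n i"
    and b: "b \<in> ideal_pow R Q (n - i)" and v: "v = w \<oplus> x [^] i \<otimes> b"
    unfolding lower_terms_Suc_iff[OF Q x] by blast
  have carr: "d \<in> carrier R" "w \<in> carrier R" "b \<in> carrier R" "x [^] i \<in> carrier R"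
    using ideal.Icarr[OF Q d] ideal.Icarr[OF lower_terms_ideal[OF Q x] w]
      ideal.Icarr[OF ideal_pow_ideal[OF Q] b] x by auto
  have "d \<otimes> v = d \<otimes> w \<oplus> x [^] i \<otimes> (d \<otimes> b)" unfolding v using carr by algebra
  moreover have "d \<otimes> w \<in> lower_terms R Q x (Suc n) i" using Suc w by simp
  moreover have "d \<otimes> b \<in> ideal_pow R Q (Suc (n - i))"
    unfolding ideal_pow_Suc2[OF Q] using d b by (rule ideal_prod.prod)
  then have "d \<otimes> b \<in> ideal_pow R Q (Suc n - i)"
    using Suc.prems by (simp only: Suc_diff_le Suc_le_mono)
  ultimately show ?case unfolding lower_terms_Suc_iff[OF Q x] by blast
qed

lemma lower_terms_shift:
  assumes Q: "ideal Q R" and x: "x \<in> carrier R"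
  shows "v \<in> lower_terms R Q x n i \<Longrightarrow> x \<otimes> v \<in> lower_terms R Q x (Suc n) (Suc i)"
proof (induct i arbitrary: v)
  case 0
  then have "x \<otimes> v = \<zero>" using x by simp
  then show ?case using ideal_zero[OF lower_terms_ideal[OF Q x]] by metis
next
  case (Suc i)
  from Suc.prems(1) obtain w b where w: "w \<in> lower_terms R Q x n i"
    and b: "b \<in> ideal_pow R Q (n - i)" and v: "v = w \<oplus> x [^] i \<otimes> b"
    unfolding lower_terms_Suc_iff[OF Q x] by blast
  have carr: "x [^] i \<in> carrier R" "w \<in> carrier R" "b \<in> carrier R"
    using ideal.Icarr[OF lower_terms_ideal[OF Q x] w]
      ideal.Icarr[OF ideal_pow_ideal[OF Q] b] x by auto
  have "x \<otimes> v = x \<otimes> w \<oplus> (x [^] i \<otimes> x) \<otimes> b" unfolding v using carr x by algebra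
  then have "x \<otimes> v = x \<otimes> w \<oplus> x [^] Suc i \<otimes> b" by simp
  moreover have "b \<in> ideal_pow R Q (Suc n - Suc i)" using b by simp
  ultimately show ?case using Suc.hyps[OF w] unfolding lower_terms_Suc_iff[OF Q x, of _ _ "Suc i"] by blast
qed

text \<open>Expansion of \<open>(Q + (x))^n\<close> by powers of \<open>x\<close>: a factor from
  \<open>Q\<close> raises only the total degree, a factor \<open>x\<close> raises both the total
  degree and the degree in \<open>x\<close>.\<close>

lemma ideal_pow_subset_lower_terms:
  assumes Q: "ideal Q R" and x: "x \<in> carrier R"
  shows "ideal_pow R (adjoin Q x) n \<subseteq> lower_terms R Q x n (Suc n)"
proof (induct n)
  case 0
  have "y \<in> lower_terms R Q x 0 (Suc 0)" if "y \<in> carrier R" for y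
    unfolding lower_terms_Suc_iff[OF Q x]
    using that ideal_pow_0[of Q] by (auto simp del: nat_pow_Suc)
  then show ?case by (simp only: ideal_pow_0 subset_iff) blast
next
  case (Suc n)
  have i: "ideal (lower_terms R Q x (Suc n) (Suc (Suc n))) R"
    by (rule lower_terms_ideal[OF Q x])
  show ?case unfolding ideal_pow_Suc
  proof (rule ideal_prod_minimal[OF i])
    fix p j assume p: "p \<in> ideal_pow R (adjoin Q x) n" and j: "j \<in> adjoin Q x"
    obtain z where z: "z \<in> carrier R" "j \<ominus> z \<otimes> x \<in> Q" using j by (rule adjoinE[OF Q x])
    have pl: "p \<in> lower_terms R Q x n (Suc n)" using Suc p by blast
    have carr: "p \<in> carrier R" "j \<in> carrier R"
      using ideal.Icarr[OF lower_terms_ideal[OF Q x] pl] ideal.Icarr[OF adjoin_ideal[OF Q x] j] .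
    have "p \<otimes> j = (j \<ominus> z \<otimes> x) \<otimes> p \<oplus> z \<otimes> (x \<otimes> p)" using carr z(1) x by algebra
    moreover have "(j \<ominus> z \<otimes> x) \<otimes> p \<in> lower_terms R Q x (Suc n) (Suc (Suc n))"
      using lower_terms_mult[OF Q x z(2) pl] lower_terms_subset_Suc[OF Q x] by blast
    moreover have "z \<otimes> (x \<otimes> p) \<in> lower_terms R Q x (Suc n) (Suc (Suc n))"
      using lower_terms_shift[OF Q x pl] z i ideal_lmult by blast
    ultimately show "p \<otimes> j \<in> lower_terms R Q x (Suc n) (Suc (Suc n))"
      using i ideal_add by simp
  qed
qed

context
  fixes Q x H
  assumes Q: "ideal Q R" and x: "x \<in> carrier R" and H: "rees_submodule R (adjoin Q x) H"
begin

lemma rees_component_ideal: "ideal (H n) R"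
  using H by (auto simp: rees_submodule_def)

lemma rees_component_mult: "\<lbrakk>d \<in> adjoin Q x; h \<in> H n\<rbrakk> \<Longrightarrow> d \<otimes> h \<in> H (Suc n)"
  using H by (auto simp: rees_submodule_def intro: ideal_prod.prod)

lemma leading_ideal_ideal: "ideal (leading_ideal R Q x H i k) R"
proof (rule idealI)
  let ?G = "leading_ideal R Q x H i k" and ?P = "ideal_pow R Q k" and ?L = "lower_terms R Q x (k + i) i"
  have L: "ideal ?L R" and P: "ideal ?P R" using Q x by (simp_all add: lower_terms_ideal ideal_pow_ideal)
  have xi: "x [^] i \<in> carrier R" using x by simp
  have mult: "r \<otimes> b \<in> ?G" if b: "b \<in> ?G" and r: "r \<in> carrier R" for r b
  proof -
    obtain h where h: "h \<in> H (k + i)" "h \<ominus> x [^] i \<otimes> b \<in> ?L" "b \<in> ?P"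
      using b by (auto simp: leading_ideal_def)
    have carr: "h \<in> carrier R" "b \<in> carrier R"
      using ideal.Icarr[OF rees_component_ideal h(1)] ideal.Icarr[OF P h(3)] .
    have "r \<otimes> h \<ominus> x [^] i \<otimes> (r \<otimes> b) = r \<otimes> (h \<ominus> x [^] i \<otimes> b)" using carr r xi by algebra
    then show ?thesis using h P L rees_component_ideal r
      by (auto simp: leading_ideal_def ideal_lmult intro!: bexI[of _ "r \<otimes> h"])
  qed
  have add: "b \<oplus> c \<in> ?G" if b: "b \<in> ?G" and c: "c \<in> ?G" for b c
  proof -
    obtain h where h: "h \<in> H (k + i)" "h \<ominus> x [^] i \<otimes> b \<in> ?L" "b \<in> ?P"
      using b by (auto simp: leading_ideal_def)
    obtain g where g: "g \<in> H (k + i)" "g \<ominus> x [^] i \<otimes> c \<in> ?L" "c \<in> ?P"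
      using c by (auto simp: leading_ideal_def)
    have carr: "h \<in> carrier R" "b \<in> carrier R" "g \<in> carrier R" "c \<in> carrier R"
      using ideal.Icarr[OF rees_component_ideal h(1)] ideal.Icarr[OF P h(3)]
        ideal.Icarr[OF rees_component_ideal g(1)] ideal.Icarr[OF P g(3)] .
    have "(h \<oplus> g) \<ominus> x [^] i \<otimes> (b \<oplus> c) = (h \<ominus> x [^] i \<otimes> b) \<oplus> (g \<ominus> x [^] i \<otimes> c)"
      using carr xi by algebra
    then show ?thesis using h g P L rees_component_ideal
      by (auto simp: leading_ideal_def ideal_add intro!: bexI[of _ "h \<oplus> g"])
  qed
  have carr: "?G \<subseteq> carrier R" using ideal_subset[OF P] by (auto simp: leading_ideal_def)
  show "ring R" by (rule ring_axioms)
  show "subgroup ?G (add_monoid R)"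
  proof (rule add.subgroupI)
    have "\<zero> \<ominus> x [^] i \<otimes> \<zero> = \<zero>" using xi by algebra
    then have "\<zero> \<in> ?G"
      using ideal_zero[OF P] ideal_zero[OF L] ideal_zero[OF rees_component_ideal, of "k + i"]
      by (auto simp: leading_ideal_def intro!: bexI[of _ \<zero>])
    then show "?G \<noteq> {}" by blast
    show "\<ominus> a \<in> ?G" if "a \<in> ?G" for a
    proof -
      have "a \<in> carrier R" using that carr by blast
      then have "\<ominus> a = (\<ominus> \<one>) \<otimes> a" by algebra
      then show ?thesis using mult[OF that] by simp
    qed
  qed (use carr add in auto)
  show "a \<otimes> b \<in> ?G" if "b \<in> ?G" "a \<in> carrier R" for a b by (rule mult[OF that])
  show "b \<otimes> a \<in> ?G" if "b \<in> ?G" "a \<in> carrier R" for a b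
    using mult[OF that] that carr m_comm by (metis subsetD)
qed

lemma leading_ideal_mult:
  assumes d: "d \<in> Q" and b: "b \<in> leading_ideal R Q x H i k"
  shows "d \<otimes> b \<in> leading_ideal R Q x H i (Suc k)"
proof -
  obtain h where h: "h \<in> H (k + i)" "h \<ominus> x [^] i \<otimes> b \<in> lower_terms R Q x (k + i) i"
    "b \<in> ideal_pow R Q k"
    using b by (auto simp: leading_ideal_def)
  have carr: "h \<in> carrier R" "b \<in> carrier R" "d \<in> carrier R" "x [^] i \<in> carrier R"
    using ideal.Icarr[OF rees_component_ideal h(1)] ideal.Icarr[OF ideal_pow_ideal[OF Q] h(3)]
      ideal.Icarr[OF Q d] x by simp_all
  have "d \<otimes> h \<ominus> x [^] i \<otimes> (d \<otimes> b) = d \<otimes> (h \<ominus> x [^] i \<otimes> b)" using carr by algebra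
  moreover have "d \<otimes> (h \<ominus> x [^] i \<otimes> b) \<in> lower_terms R Q x (Suc (k + i)) i"
    using h by (intro lower_terms_mult[OF Q x d]) auto
  moreover have "d \<otimes> h \<in> H (Suc (k + i))" using rees_component_mult adjoin_subset[OF Q x] d h by blast
  moreover have "d \<otimes> b \<in> ideal_pow R Q (Suc k)"
    unfolding ideal_pow_Suc2[OF Q] using d h(3) by (rule ideal_prod.prod)
  ultimately show ?thesis by (auto simp: leading_ideal_def simp del: nat_pow_Suc intro!: bexI[of _ "d \<otimes> h"])
qed

lemma leading_ideal_rees: "rees_submodule R Q (leading_ideal R Q x H i)"
  unfolding rees_submodule_def
proof (intro allI conjI)
  fix k
  show "ideal (leading_ideal R Q x H i k) R" by (rule leading_ideal_ideal)
  show "leading_ideal R Q x H i k \<subseteq> ideal_pow R Q k" by (auto simp: leading_ideal_def)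
  show "Q \<cdot> leading_ideal R Q x H i k \<subseteq> leading_ideal R Q x H i (Suc k)"
    by (intro ideal_prod_minimal leading_ideal_ideal leading_ideal_mult)
qed

text \<open>Multiplying the witness by \<open>x\<close> keeps its leading coefficient and raises its
  degree in \<open>x\<close> by one.\<close>

lemma leading_ideal_subset_Suc: "leading_ideal R Q x H i k \<subseteq> leading_ideal R Q x H (Suc i) k"
proof
  fix b assume "b \<in> leading_ideal R Q x H i k"
  then obtain h where h: "h \<in> H (k + i)" "h \<ominus> x [^] i \<otimes> b \<in> lower_terms R Q x (k + i) i"
    "b \<in> ideal_pow R Q k"
    by (auto simp: leading_ideal_def)
  have carr: "h \<in> carrier R" "b \<in> carrier R" "x [^] i \<in> carrier R"
    using ideal.Icarr[OF rees_component_ideal h(1)] ideal.Icarr[OF ideal_pow_ideal[OF Q] h(3)] x by simp_all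
  have "x \<otimes> h \<ominus> (x [^] i \<otimes> x) \<otimes> b = x \<otimes> (h \<ominus> x [^] i \<otimes> b)" using carr x by algebra
  then have "x \<otimes> h \<ominus> x [^] Suc i \<otimes> b \<in> lower_terms R Q x (Suc (k + i)) (Suc i)"
    using lower_terms_shift[OF Q x h(2)] by (simp del: lower_terms.simps)
  moreover have "x \<otimes> h \<in> H (Suc (k + i))" using rees_component_mult adjoin_self[OF Q x] h by blast
  ultimately show "b \<in> leading_ideal R Q x H (Suc i) k"
    using h by (auto simp: leading_ideal_def simp del: nat_pow_Suc lower_terms.simps)
qed

lemma leading_ideal_mono: "i \<le> j \<Longrightarrow> leading_ideal R Q x H i k \<subseteq> leading_ideal R Q x H j k"
  using lift_Suc_mono_le[of "\<lambda>i. leading_ideal R Q x H i k"] leading_ideal_subset_Suc by blast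

text \<open>Subtracting elements of \<open>(Q + (x)) H\<^sub>n\<close> with the same leading term lowers the degree in \<open>x\<close>.\<close>

lemma rees_descent:
  assumes lead: "\<And>i. i \<le> Suc n \<Longrightarrow>
      leading_ideal R Q x H i (Suc n - i) \<subseteq> Q \<cdot> leading_ideal R Q x H i (n - i) \<and> i \<le> n \<or>
      (\<exists>j. i = Suc j \<and> leading_ideal R Q x H i (Suc n - i) \<subseteq> leading_ideal R Q x H j (Suc n - i))"
  shows "\<lbrakk>h \<in> H (Suc n); h \<in> lower_terms R Q x (Suc n) i; i \<le> Suc (Suc n)\<rbrakk>
    \<Longrightarrow> h \<in> adjoin Q x \<cdot> H n"
proof (induct i arbitrary: h)
  have JH: "ideal (adjoin Q x \<cdot> H n) R"
    by (rule ideal_prod_is_ideal[OF adjoin_ideal[OF Q x] rees_component_ideal])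
  {
    case 0
    then show ?case using ideal_zero[OF JH] by simp
  next
    case (Suc i)
    let ?L = "lower_terms R Q x (Suc n) i"
    have L: "ideal ?L R" by (rule lower_terms_ideal[OF Q x])
    from Suc.prems(2) obtain w b where w: "w \<in> ?L"
      and b: "b \<in> ideal_pow R Q (Suc n - i)" and h: "h = w \<oplus> x [^] i \<otimes> b"
      unfolding lower_terms_Suc_iff[OF Q x] by blast
    have i: "i \<le> Suc n" and xi: "x [^] i \<in> carrier R" using Suc.prems x by auto
    have carr: "w \<in> carrier R" "b \<in> carrier R"
      using ideal.Icarr[OF L w] ideal.Icarr[OF ideal_pow_ideal[OF Q] b] .
    have "h \<ominus> x [^] i \<otimes> b = w" unfolding h using carr xi by algebra
    then have bG: "b \<in> leading_ideal R Q x H i (Suc n - i)"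
      using w b Suc.prems(1) i by (auto simp: leading_ideal_def)
    \<comment> \<open>The element to subtract from \<open>h\<close>. In the first case of
      \<open>lead\<close> it is a sum of products \<open>d g\<close> with \<open>d \<in> Q\<close>,
      in the second it is \<open>x g\<close>.\<close>
    have "\<exists>g\<in>adjoin Q x \<cdot> H n. g \<in> H (Suc n) \<and> g \<ominus> x [^] i \<otimes> b \<in> ?L"
      using lead[OF i]
    proof (elim disjE conjE exE)
      assume "leading_ideal R Q x H i (Suc n - i) \<subseteq> Q \<cdot> leading_ideal R Q x H i (n - i)" and "i \<le> n"
      then have "b \<in> Q \<cdot> leading_ideal R Q x H i (n - i)" using bG by blast
      then show ?thesis
      proof induct
        case (prod d c)
        then obtain g where g: "g \<in> H n" "g \<ominus> x [^] i \<otimes> c \<in> lower_terms R Q x n i"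
          "c \<in> ideal_pow R Q (n - i)"
          using \<open>i \<le> n\<close> by (auto simp: leading_ideal_def)
        have dc: "d \<in> adjoin Q x" using prod adjoin_subset[OF Q x] by blast
        have carr: "g \<in> carrier R" "c \<in> carrier R" "d \<in> carrier R"
          using ideal.Icarr[OF rees_component_ideal g(1)] ideal.Icarr[OF ideal_pow_ideal[OF Q] g(3)]
            ideal.Icarr[OF Q prod(1)] .
        have "d \<otimes> g \<ominus> x [^] i \<otimes> (d \<otimes> c) = d \<otimes> (g \<ominus> x [^] i \<otimes> c)" using carr xi by algebra
        moreover have "d \<otimes> (g \<ominus> x [^] i \<otimes> c) \<in> ?L"
          using lower_terms_mult[OF Q x _ g(2)] prod \<open>i \<le> n\<close> by simp
        ultimately show ?case using dc g rees_component_mult by (auto intro!: bexI[of _ "d \<otimes> g"] ideal_prod.prod)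
      next
        case (sum c c')
        then obtain g g' where g: "g \<in> adjoin Q x \<cdot> H n" "g \<in> H (Suc n)" "g \<ominus> x [^] i \<otimes> c \<in> ?L"
            "g' \<in> adjoin Q x \<cdot> H n" "g' \<in> H (Suc n)" "g' \<ominus> x [^] i \<otimes> c' \<in> ?L" by blast
        have carr: "g \<in> carrier R" "g' \<in> carrier R" "c \<in> carrier R" "c' \<in> carrier R"
          using ideal.Icarr[OF rees_component_ideal g(2)] ideal.Icarr[OF rees_component_ideal g(5)]
            subsetD[OF ideal_prod_in_carrier[OF Q leading_ideal_ideal] sum(1)]
            subsetD[OF ideal_prod_in_carrier[OF Q leading_ideal_ideal] sum(3)] .
        have "(g \<oplus> g') \<ominus> x [^] i \<otimes> (c \<oplus> c') = (g \<ominus> x [^] i \<otimes> c) \<oplus> (g' \<ominus> x [^] i \<otimes> c')"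
          using carr xi by algebra
        then show ?case using g JH L rees_component_ideal by (intro bexI[of _ "g \<oplus> g'"]) (auto simp: ideal_add)
      qed
    next
      fix j assume j: "i = Suc j"
        and "leading_ideal R Q x H i (Suc n - i) \<subseteq> leading_ideal R Q x H j (Suc n - i)"
      then have "b \<in> leading_ideal R Q x H j (n - j)" and nj: "n - j + j = n" using bG i by auto
      then obtain g where g: "g \<in> H n" "g \<ominus> x [^] j \<otimes> b \<in> lower_terms R Q x n j"
        unfolding leading_ideal_def by (auto simp: nj)
      have carr': "g \<in> carrier R" "x [^] j \<in> carrier R" using ideal.Icarr[OF rees_component_ideal g(1)] x by simp_all
      have "x \<otimes> g \<ominus> (x [^] j \<otimes> x) \<otimes> b = x \<otimes> (g \<ominus> x [^] j \<otimes> b)" using carr carr' x by algebra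
      then have "x \<otimes> g \<ominus> x [^] i \<otimes> b \<in> ?L"
        using lower_terms_shift[OF Q x g(2)] by (simp add: j del: lower_terms.simps)
      moreover have "x \<otimes> g \<in> adjoin Q x \<cdot> H n" "x \<otimes> g \<in> H (Suc n)"
        using g adjoin_self[OF Q x] by (auto intro: ideal_prod.prod rees_component_mult)
      ultimately show ?thesis by blast
    qed
    then obtain g where g: "g \<in> adjoin Q x \<cdot> H n" "g \<in> H (Suc n)" "g \<ominus> x [^] i \<otimes> b \<in> ?L" by blast
    have gc: "g \<in> carrier R" by (rule ideal.Icarr[OF rees_component_ideal g(2)])
    have "h \<ominus> g = w \<ominus> (g \<ominus> x [^] i \<otimes> b)" unfolding h using carr xi gc by algebra
    then have "h \<ominus> g \<in> ?L" using L w g ideal_diff by simp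
    moreover have "h \<ominus> g \<in> H (Suc n)" using Suc.prems g rees_component_ideal ideal_diff by blast
    ultimately have "h \<ominus> g \<in> adjoin Q x \<cdot> H n" using Suc by simp
    moreover have "h = (h \<ominus> g) \<oplus> g" unfolding h using carr xi gc by algebra
    ultimately show ?case using g JH ideal_add by metis
  }
qed

end

end


section \<open>Stability by induction on the generators of \<open>J\<close>\<close>

locale noetherian_cring = cring R + noetherian_ring R for R (structure)
begin

lemma ascending_ideals_stable:
  assumes "\<And>i::nat. ideal (I i) R" "\<And>i. I i \<subseteq> I (Suc i)"
  obtains m where "(\<Union>i. I i) = I m"
proof -
  have "I i \<subseteq> I j" if "i \<le> j" for i j using lift_Suc_mono_le[of I] assms(2) that by blast
  then have "I i \<subseteq> I j \<or> I j \<subseteq> I i" for i j by (meson nat_le_linear)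
  then have "subset.chain {K. ideal K R} (range I)"
    using assms(1) unfolding pred_on.chain_def psubset_eq by blast
  then show ?thesis using ideal_chain_is_trivial[of "range I"] that by auto
qed

text \<open>Hilbert's basis argument. For each \<open>k\<close> the chain \<open>G i k\<close> in
  \<open>i\<close> becomes stationary, but the stage depends on \<open>k\<close>. Applying the
  induction hypothesis to the union \<open>U\<close> of the rows makes the stage uniform; applying
  it to the remaining rows bounds the degrees of their generators.\<close>

lemma rees_submodule_adjoin:
  assumes Q: "ideal Q R" and x: "x \<in> carrier R"
    and IH: "\<And>H. rees_submodule R Q H \<Longrightarrow> \<exists>c. \<forall>n\<ge>c. H (Suc n) \<subseteq> Q \<cdot> H n"
    and H: "rees_submodule R (adjoin Q x) H"
  shows "\<exists>c. \<forall>n\<ge>c. H (Suc n) \<subseteq> adjoin Q x \<cdot> H n"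
proof -
  define G where "G = leading_ideal R Q x H"
  define U where "U k = (\<Union>i. G i k)" for k
  note facts = leading_ideal_ideal[OF Q x H, folded G_def] leading_ideal_subset_Suc[OF Q x H, folded G_def]
    leading_ideal_mono[OF Q x H, folded G_def]
  have rees: "rees_submodule R Q (G i)" for i unfolding G_def by (rule leading_ideal_rees[OF Q x H])
  have "\<exists>m. U k = G m k" for k
    unfolding U_def using ascending_ideals_stable[of "\<lambda>i. G i k"] facts(1,2) by metis
  then obtain m where m: "\<And>k. U k = G (m k) k" by metis
  have "rees_submodule R Q U"
    unfolding rees_submodule_def
  proof (intro allI conjI)
    fix k
    show "ideal (U k) R" unfolding m by (rule facts(1))
    show "U k \<subseteq> ideal_pow R Q k" unfolding m using rees by (simp add: rees_submodule_def)
    have "Q \<cdot> U k \<subseteq> G (m k) (Suc k)" unfolding m[of k] using rees by (simp add: rees_submodule_def)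
    then show "Q \<cdot> U k \<subseteq> U (Suc k)" by (auto simp: U_def)
  qed
  then obtain c where c: "\<And>k. k \<ge> c \<Longrightarrow> U (Suc k) \<subseteq> Q \<cdot> U k" using IH by blast
  \<comment> \<open>Each \<open>U k\<close> with \<open>k \<le> c\<close> is reached at its own
    stage \<open>m k\<close>, and the maximum serves them all. Beyond \<open>c\<close>, stability of
    \<open>U\<close> gives \<open>U (Suc k) \<subseteq> Q \<cdot> U k\<close>, which stays in row
    \<open>i0\<close>.\<close>
  define i0 where "i0 = Max (m ` {..c})"
  have U: "U k \<subseteq> G i0 k" for k
  proof (cases "k \<le> c")
    case True
    then show ?thesis unfolding m using facts(3)[of "m k" i0 k] by (simp add: i0_def)
  next
    case False
    then have "c \<le> k" by simp
    then show ?thesis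
    proof (induct k rule: dec_induct)
      case base
      then show ?case unfolding m using facts(3)[of "m c" i0 c] by (simp add: i0_def)
    next
      case (step k)
      then have "U (Suc k) \<subseteq> Q \<cdot> G i0 k" using c ideal_prod_mono[of Q Q "U k" "G i0 k"] by blast
      moreover have "Q \<cdot> G i0 k \<subseteq> G i0 (Suc k)" using rees by (simp add: rees_submodule_def)
      ultimately show ?case by blast
    qed
  qed
  obtain d where d: "\<And>i n. n \<ge> d i \<Longrightarrow> G i (Suc n) \<subseteq> Q \<cdot> G i n" using IH[OF rees] by metis
  \<comment> \<open>The rows above \<open>i0\<close> repeat row \<open>i0\<close>, so only finitely
    many thresholds \<open>d i\<close> count. Row \<open>i\<close> is used at index
    \<open>n - i\<close>, hence the bound \<open>D + i0\<close> on \<open>n\<close>.\<close>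
  define D where "D = Max (d ` {..i0})"
  show ?thesis
  proof (intro exI allI impI subsetI)
    fix n h assume n: "D + i0 \<le> n" and h: "h \<in> H (Suc n)"
    have "h \<in> lower_terms R Q x (Suc n) (Suc (Suc n))"
      using h H ideal_pow_subset_lower_terms[OF Q x, of "Suc n"] unfolding rees_submodule_def by blast
    then show "h \<in> adjoin Q x \<cdot> H n"
    proof (rule rees_descent[OF Q x H _ h, rotated, folded G_def])
      fix i assume "i \<le> Suc n"
      show "G i (Suc n - i) \<subseteq> Q \<cdot> G i (n - i) \<and> i \<le> n \<or>
        (\<exists>j. i = Suc j \<and> G i (Suc n - i) \<subseteq> G j (Suc n - i))"
      proof (cases "i \<le> i0")
        case True
        then have "d i \<le> D" by (simp add: D_def)
        then have "d i \<le> n - i" "i \<le> n" using True n by auto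
        then show ?thesis using d[of i "n - i"] by (simp add: Suc_diff_le)
      next
        case False
        then obtain j where j: "i = Suc j" "i0 \<le> j" by (cases i) auto
        have "G i (Suc n - i) \<subseteq> G j (Suc n - i)"
          using U[of "Suc n - i"] facts(3)[OF j(2)] unfolding U_def by blast
        then show ?thesis using j by blast
      qed
    qed simp
  qed
qed

lemma rees_submodule_stable:
  assumes "finite A" "A \<subseteq> carrier R" "rees_submodule R (Idl A) H"
  shows "\<exists>c. \<forall>n\<ge>c. H (Suc n) \<subseteq> (Idl A) \<cdot> H n"
  using assms
proof (induct A arbitrary: H)
  case empty
  have "Idl {} = {\<zero>}" using genideal_minimal[OF zeroideal, of "{}"] ideal_zero[OF genideal_ideal[of "{}"]] by auto
  then have z: "ideal_pow R (Idl {}) (Suc n) = {\<zero>}" for n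
    unfolding ideal_pow_Suc using ideal_prod_zero[OF ideal_pow_ideal[OF zeroideal]] by simp
  have "H (Suc n) \<subseteq> (Idl {}) \<cdot> H n" for n
  proof -
    have "H (Suc n) \<subseteq> ideal_pow R (Idl {}) (Suc n)"
      using empty(2)[unfolded rees_submodule_def] by (elim allE conjE)
    then have "H (Suc n) \<subseteq> {\<zero>}" unfolding z .
    moreover have "ideal ((Idl {}) \<cdot> H n) R"
      using empty(2) genideal_ideal[of "{}"] by (simp add: rees_submodule_def ideal_prod_is_ideal)
    ultimately show ?thesis using ideal_zero by blast
  qed
  then show ?case by blast
next
  case (insert x A)
  then show ?case
    using rees_submodule_adjoin[of "Idl A" x H] by (simp add: Idl_insert genideal_ideal)
qed

text \<open>The family \<open>J^n \<inter> I\<close> is a homogeneous ideal of the Rees algebra, so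
  its stability gives one inclusion; the other holds for all \<open>n\<close>.\<close>

theorem artin_rees:
  assumes J: "ideal J R" and I: "ideal I R"
  shows "\<exists>c. \<forall>n\<ge>c. ideal_pow R J (Suc n) \<inter> I = J \<cdot> (ideal_pow R J n \<inter> I)"
proof -
  obtain A where A: "A \<subseteq> carrier R" "finite A" "J = Idl A" using finetely_gen[OF J] by blast
  let ?H = "\<lambda>n. ideal_pow R J n \<inter> I"
  have *: "J \<cdot> ?H n \<subseteq> ?H (Suc n)" for n
    unfolding ideal_pow_Suc2[OF J]
    using ideal_prod_mono[of J J "?H n" "ideal_pow R J n"] ideal_prod_mono[of J J "?H n" I]
      ideal_prod_inter[OF J I] by blast
  then have "rees_submodule R J ?H"
    unfolding rees_submodule_def using i_intersect[OF ideal_pow_ideal[OF J] I] by blast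
  then obtain c where "\<And>n. n \<ge> c \<Longrightarrow> ?H (Suc n) \<subseteq> J \<cdot> ?H n"
    unfolding A(3) using rees_submodule_stable[OF A(2,1)] by meson
  then show ?thesis using * by (intro exI[of _ c] allI impI subset_antisym)
qed

end

section \<open>Perturbing one element\<close>

text \<open>Ideal powers are \<open>nat_pow\<close> in \<open>ideals_set R\<close>, so as simp rules
  these would also unfold \<open>P (Suc n)\<close> and \<open>P 0\<close>.\<close>

declare nat_pow_Suc [simp del] nat_pow_0 [simp del]

text \<open>Locality enters only through the fact that \<open>J\<close> lies in the Jacobson
  radical, and this serves Krull's intersection theorem.\<close>

locale radical_adic = noetherian_cring R for R (structure) +
  fixes J
  assumes J: "ideal J R" and one_minus_unit: "j \<in> J \<Longrightarrow> \<one> \<ominus> j \<in> Units R"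
begin

abbreviation P :: "nat \<Rightarrow> 'a set" where "P n \<equiv> ideal_pow R J n"

definition artin_rees_exact :: "'a set \<Rightarrow> nat \<Rightarrow> bool" where
  "artin_rees_exact I c \<longleftrightarrow> (\<forall>n\<ge>c. P (Suc n) \<inter> I = J \<cdot> (P n \<inter> I))"

text \<open>The form in which Artin-Rees enters the descents: the order drops by at most
  \<open>c\<close>. Truncated subtraction makes the condition trivial for
  \<open>n \<le> c\<close>.\<close>

definition artin_rees_bound :: "'a set \<Rightarrow> nat \<Rightarrow> bool" where
  "artin_rees_bound I c \<longleftrightarrow> (\<forall>n. P n \<inter> I \<subseteq> P (n - c) \<cdot> I)"

text \<open>The inclusion \<open>in(I) \<subseteq> in(I')\<close>, stated with elements of
  \<open>R\<close> instead of classes. That \<open>x'\<close> lies in \<open>P n\<close> follows,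
  since \<open>x\<close> and \<open>x \<ominus> x'\<close> do.\<close>

definition initial_le :: "'a set \<Rightarrow> 'a set \<Rightarrow> bool" where
  "initial_le I I' \<longleftrightarrow> (\<forall>n. \<forall>x\<in>P n \<inter> I. \<exists>x'\<in>I'. x \<ominus> x' \<in> P (Suc n))"

lemma P_ideal: "ideal (P n) R"
  by (rule ideal_pow_ideal[OF J])

lemma P_carr: "x \<in> P n \<Longrightarrow> x \<in> carrier R"
  by (rule ideal.Icarr[OF P_ideal])

lemma P_antimono: "m \<le> n \<Longrightarrow> P n \<subseteq> P m"
  by (rule ideal_pow_antimono[OF J])

lemma P_mult: "\<lbrakk>x \<in> P m; y \<in> P n; k \<le> m + n\<rbrakk> \<Longrightarrow> x \<otimes> y \<in> P k"
  by (rule ideal_pow_mult_mem_le[OF J])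

lemma artin_rees_exact_imp_bound:
  assumes "artin_rees_exact I c" and I: "ideal I R"
  shows "artin_rees_bound I c"
  unfolding artin_rees_bound_def
proof
  fix n
  show "P n \<inter> I \<subseteq> P (n - c) \<cdot> I"
  proof (cases "n \<le> c")
    case True
    then have "n - c = 0" by simp
    then have "P (n - c) \<cdot> I = I"
      by (simp only: ideal_pow_0) (metis ideal_prod_commute ideal_prod_one oneideal I)
    then show ?thesis by simp
  next
    case False
    then have "c \<le> n" by simp
    then show ?thesis
    proof (induct n rule: dec_induct)
      case base
      have "P (c - c) \<cdot> I = I"
        by (simp only: ideal_pow_0 diff_self_eq_0) (metis ideal_prod_commute ideal_prod_one oneideal I)
      then show ?case by simp
    next
      case (step n)
      have "P (Suc n) \<inter> I = J \<cdot> (P n \<inter> I)"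
        using assms step(1) by (simp only: artin_rees_exact_def)
      also have "\<dots> \<subseteq> J \<cdot> (P (n - c) \<cdot> I)" using step by (intro ideal_prod_mono) auto
      also have "\<dots> = P (Suc (n - c)) \<cdot> I"
        by (simp only: ideal_pow_Suc2[OF J] ideal_prod_assoc[OF J P_ideal I])
      finally show ?case using step(1) by (simp only: Suc_diff_le)
    qed
  qed
qed

lemma artin_rees_exact_ex:
  assumes "ideal I R" shows "\<exists>c. artin_rees_exact I c"
  using artin_rees[OF J assms] by (simp only: artin_rees_exact_def)

text \<open>Artin-Rees for \<open>(K, x)\<close> gives \<open>x = j x\<close> modulo
  \<open>K\<close> with \<open>j \<in> J\<close>, and \<open>1 - j\<close> is a unit. In other
  words, \<open>K\<close> is closed in the \<open>J\<close>-adic topology.\<close>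

theorem krull_intersection:
  assumes K: "ideal K R" and x: "x \<in> carrier R" and xK: "\<And>n. x \<in> K <+>\<^bsub>R\<^esub> P n"
  shows "x \<in> K"
proof -
  have M: "ideal (adjoin K x) R" by (rule adjoin_ideal[OF K x])
  obtain c where c: "artin_rees_bound (adjoin K x) c"
    using artin_rees_exact_ex[OF M] artin_rees_exact_imp_bound[OF _ M] by blast
  \<comment> \<open>One power beyond the Artin-Rees exponent leaves exactly one factor
    \<open>J\<close>.\<close>
  obtain k p where kp: "k \<in> K" "p \<in> P (Suc c)" "x = k \<oplus> p"
    using xK[of "Suc c"] by (auto simp: set_add_mem_iff)
  have carr: "k \<in> carrier R" "p \<in> carrier R" using kp ideal.Icarr[OF K] P_carr by auto
  have "p = x \<ominus> k" unfolding kp(3) using carr by algebra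
  then have "p \<in> adjoin K x"
    using kp(1) adjoin_subset[OF K x] adjoin_self[OF K x] ideal_diff[OF M] by auto
  then have "p \<in> P (Suc c - c) \<cdot> adjoin K x"
    using c kp(2) unfolding artin_rees_bound_def by blast
  then have "p \<in> J \<cdot> adjoin K x" by (simp add: ideal_pow_1[OF J] Suc_diff_le del: nat_pow_Suc)
  then obtain j where j: "j \<in> J" "p \<ominus> j \<otimes> x \<in> K" using adjoin_prod_mem[OF K x J] by blast
  have jc: "j \<in> carrier R" by (rule ideal.Icarr[OF J j(1)])
  have u: "\<one> \<ominus> j \<in> Units R" by (rule one_minus_unit[OF j(1)])
  have "(\<one> \<ominus> j) \<otimes> x = x \<ominus> j \<otimes> x" using x jc by algebra
  also have "\<dots> = k \<oplus> (p \<ominus> j \<otimes> x)" using kp(3) carr jc x by algebra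
  finally have "(\<one> \<ominus> j) \<otimes> x \<in> K" using j(2) kp(1) ideal_add[OF K] by simp
  then have "inv (\<one> \<ominus> j) \<otimes> ((\<one> \<ominus> j) \<otimes> x) \<in> K" using ideal_lmult[OF K] u by simp
  then show ?thesis using u x jc by (simp add: m_assoc[symmetric])
qed

section \<open>Comparison of initial ideals\<close>

lemma initial_le_refl: "ideal I R \<Longrightarrow> initial_le I I"
  unfolding initial_le_def using ideal_zero[OF P_ideal] P_carr
  by (metis IntD1 IntD2 r_right_minus_eq)

lemma initial_le_mem:
  assumes "initial_le I I'" "x \<in> P n" "x \<in> I" and I': "ideal I' R"
  obtains x' where "x' \<in> I'" "x' \<in> P n" "x \<ominus> x' \<in> P (Suc n)"
proof -
  obtain x' where x': "x' \<in> I'" "x \<ominus> x' \<in> P (Suc n)" using assms unfolding initial_le_def by blast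
  have "x' \<in> carrier R" "x \<in> carrier R" using ideal.Icarr[OF I' x'(1)] P_carr[OF assms(2)] .
  then have eq: "x \<ominus> (x \<ominus> x') = x'" by algebra
  have "x \<ominus> x' \<in> P n" using x'(2) P_antimono[of n "Suc n"] by auto
  then have "x' \<in> P n" using ideal_diff[OF P_ideal assms(2)] eq by metis
  then show ?thesis using that x' by blast
qed

lemma initial_le_trans:
  assumes "initial_le I I'" "initial_le I' I''" "ideal I' R" "ideal I'' R"
  shows "initial_le I I''"
  unfolding initial_le_def
proof (intro allI ballI)
  fix n x assume x: "x \<in> P n \<inter> I"
  then obtain x' where x': "x' \<in> I'" "x' \<in> P n" "x \<ominus> x' \<in> P (Suc n)"
    using initial_le_mem[OF assms(1) _ _ assms(3)] by blast
  then obtain x'' where x'': "x'' \<in> I''" "x'' \<in> P n" "x' \<ominus> x'' \<in> P (Suc n)"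
    using initial_le_mem[OF assms(2) _ _ assms(4)] by blast
  have carr: "x \<in> carrier R" "x' \<in> carrier R" "x'' \<in> carrier R" using x x' x'' P_carr by blast+
  have "x \<ominus> x'' = (x \<ominus> x') \<oplus> (x' \<ominus> x'')" using carr by algebra
  then show "\<exists>x''\<in>I''. x \<ominus> x'' \<in> P (Suc n)" using x' x'' ideal_add[OF P_ideal] by metis
qed

text \<open>An element of \<open>P (Suc n) \<inter> I'\<close> is corrected degree by degree:
  approximate it in \<open>I\<close>, factor the approximation there, and lift the factors from
  \<open>I\<close> back to \<open>I'\<close>. The remainder stays in \<open>I'\<close> and lies one
  power deeper.\<close>

lemma initial_le_artin_rees_exact:
  assumes I: "ideal I R" and I': "ideal I' R" and le: "initial_le I I'" and ge: "initial_le I' I"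
    and c: "artin_rees_exact I c"
  shows "artin_rees_exact I' c"
  unfolding artin_rees_exact_def
proof (intro allI impI subset_antisym)
  fix n assume n: "c \<le> n"
  let ?K = "J \<cdot> (P n \<inter> I')"
  have PI: "ideal (P m \<inter> I) R" "ideal (P m \<inter> I') R" for m using i_intersect[OF P_ideal] I I' by auto
  have K: "ideal ?K R" by (rule ideal_prod_is_ideal[OF J PI(2)])
  have lift: "\<exists>s'\<in>J \<cdot> (P q \<inter> I'). s \<ominus> s' \<in> P (Suc (Suc q))" if "s \<in> J \<cdot> (P q \<inter> I)" for q s
    using that
  proof induct
    case (prod j y)
    then obtain y' where y': "y' \<in> I'" "y' \<in> P q" "y \<ominus> y' \<in> P (Suc q)"
      using initial_le_mem[OF le _ _ I'] by blast
    have carr: "j \<in> carrier R" "y \<in> carrier R" "y' \<in> carrier R"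
      using ideal.Icarr[OF J prod(1)] prod(2) y' P_carr by blast+
    have "j \<otimes> y \<ominus> j \<otimes> y' = j \<otimes> (y \<ominus> y')" using carr by algebra
    also have "\<dots> \<in> P (Suc (Suc q))" unfolding ideal_pow_Suc2[OF J, of "Suc q"]
      using prod(1) y'(3) by (rule ideal_prod.prod)
    finally show ?case using prod(1) y' by (blast intro: ideal_prod.prod)
  next
    case (sum s t)
    then obtain s' t' where st: "s' \<in> J \<cdot> (P q \<inter> I')" "s \<ominus> s' \<in> P (Suc (Suc q))"
      "t' \<in> J \<cdot> (P q \<inter> I')" "t \<ominus> t' \<in> P (Suc (Suc q))" by blast
    have carr: "s \<in> carrier R" "t \<in> carrier R" "s' \<in> carrier R" "t' \<in> carrier R"
      using sum(1,3) st ideal_prod_in_carrier[OF J PI(1)] ideal_prod_in_carrier[OF J PI(2)] by blast+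
    have "(s \<oplus> t) \<ominus> (s' \<oplus> t') = (s \<ominus> s') \<oplus> (t \<ominus> t')" using carr by algebra
    then show ?case using st ideal_add[OF P_ideal] by (metis ideal_prod.sum)
  qed
  have approx: "P (Suc n) \<inter> I' \<subseteq> ?K <+>\<^bsub>R\<^esub> (P (Suc (n + m)) \<inter> I')" for m
  proof (induct m)
    case 0
    then show ?case using subset_set_add2[OF K PI(2)] by simp
  next
    case (Suc m)
    let ?q = "n + m"
    have "P (Suc ?q) \<inter> I' \<subseteq> ?K <+>\<^bsub>R\<^esub> (P (Suc (Suc ?q)) \<inter> I')"
    proof
      fix x' assume x': "x' \<in> P (Suc ?q) \<inter> I'"
      then obtain x where x: "x \<in> I" "x \<in> P (Suc ?q)" "x' \<ominus> x \<in> P (Suc (Suc ?q))"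
        using initial_le_mem[OF ge _ _ I] by blast
      have "x \<in> J \<cdot> (P ?q \<inter> I)" using c x n unfolding artin_rees_exact_def by (metis IntI le_add1 le_trans)
      then obtain s where s: "s \<in> J \<cdot> (P ?q \<inter> I')" "x \<ominus> s \<in> P (Suc (Suc ?q))" using lift by blast
      have sK: "s \<in> ?K" using s(1) ideal_prod_mono[of J J "P ?q \<inter> I'" "P n \<inter> I'"] P_antimono[of n ?q] by auto
      have sI: "s \<in> I'" using s(1) ideal_prod_inter[OF J PI(2)] by blast
      have carr: "x' \<in> carrier R" "x \<in> carrier R" "s \<in> carrier R"
        using x' x P_carr ideal.Icarr[OF I' sI] by blast+
      have "x' \<ominus> s = (x' \<ominus> x) \<oplus> (x \<ominus> s)" using carr by algebra
      then have "x' \<ominus> s \<in> P (Suc (Suc ?q))" using x(3) s(2) ideal_add[OF P_ideal] by metis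
      moreover have "x' \<ominus> s \<in> I'" using x' sI ideal_diff[OF I'] by blast
      moreover have "x' = s \<oplus> (x' \<ominus> s)" using carr by algebra
      ultimately show "x' \<in> ?K <+>\<^bsub>R\<^esub> (P (Suc (Suc ?q)) \<inter> I')"
        unfolding set_add_mem_iff using sK by blast
    qed
    then have "?K <+>\<^bsub>R\<^esub> (P (Suc ?q) \<inter> I') \<subseteq> ?K <+>\<^bsub>R\<^esub> (P (Suc (Suc ?q)) \<inter> I')"
      using subset_set_add1[OF K PI(2)] by (intro set_add_minimal add_ideals K PI)
    then show ?case using subset_trans[OF Suc] by simp
  qed
  \<comment> \<open>The Artin-Rees lemma for \<open>I'\<close> itself, with an exponent of any size,
    absorbs the remainder after finitely many corrections; no limit is taken.\<close>
  obtain c' where c': "artin_rees_exact I' c'" using artin_rees_exact_ex[OF I'] by blast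
  have "P (Suc (n + c')) \<inter> I' = J \<cdot> (P (n + c') \<inter> I')"
    using c' unfolding artin_rees_exact_def by (metis le_add2)
  also have "\<dots> \<subseteq> ?K" using P_antimono[of n "n + c'"] by (intro ideal_prod_mono) auto
  finally have "?K <+>\<^bsub>R\<^esub> (P (Suc (n + c')) \<inter> I') \<subseteq> ?K" by (intro set_add_minimal K) auto
  then show "P (Suc n) \<inter> I' \<subseteq> ?K" using approx[of c'] by blast
  show "?K \<subseteq> P (Suc n) \<inter> I'"
    unfolding ideal_pow_Suc2[OF J]
    using ideal_prod_mono[of J J "P n \<inter> I'" "P n"] ideal_prod_mono[of J J "P n \<inter> I'" I']
      ideal_prod_inter[OF J I'] by blast
qed

text \<open>Write \<open>x = z f\<close> modulo \<open>L\<close> with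
  \<open>z \<in> P (n - A)\<close>. Then \<open>x + z e = z (f + e)\<close> modulo \<open>L\<close>,
  and \<open>z e\<close> has order greater than \<open>n\<close> because
  \<open>A < N\<close>.\<close>

lemma initial_le_perturb:
  assumes L: "ideal L R" and f: "f \<in> carrier R" and e: "e \<in> P N"
    and A: "artin_rees_bound (adjoin L f) A" "A < N"
  shows "initial_le (adjoin L f) (adjoin L (f \<oplus> e))"
  unfolding initial_le_def
proof (intro allI ballI)
  fix n x assume x: "x \<in> P n \<inter> adjoin L f"
  then have "x \<in> P (n - A) \<cdot> adjoin L f" using A unfolding artin_rees_bound_def by blast
  then obtain z where z: "z \<in> P (n - A)" "x \<ominus> z \<otimes> f \<in> L" using adjoin_prod_mem[OF L f P_ideal] by blast
  have carr: "x \<in> carrier R" "z \<in> carrier R" "e \<in> carrier R" using x z e P_carr by blast+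
  have "x \<oplus> z \<otimes> e \<ominus> z \<otimes> (f \<oplus> e) = x \<ominus> z \<otimes> f" using carr f by algebra
  then have "x \<oplus> z \<otimes> e \<in> adjoin L (f \<oplus> e)"
    using adjoinI[OF L _ _ carr(2), of "f \<oplus> e" "x \<oplus> z \<otimes> e"] z carr f by simp
  moreover have "x \<ominus> (x \<oplus> z \<otimes> e) = \<ominus> (z \<otimes> e)" using carr by algebra
  moreover have "z \<otimes> e \<in> P (Suc n)" using z e A by (intro P_mult[of _ "n - A" _ N]) auto
  ultimately show "\<exists>x'\<in>adjoin L (f \<oplus> e). x \<ominus> x' \<in> P (Suc n)"
    using ideal_neg[OF P_ideal] by metis
qed

section \<open>Descent for an error \<open>e\<close> that kills \<open>(L : f) / L\<close>\<close>

context
  fixes L f e N A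
  assumes L: "ideal L R" and f: "f \<in> carrier R" and e: "e \<in> P N"
    and A: "artin_rees_bound (adjoin L f) A" "A < N"
    and kill: "\<And>u. u \<in> colon R L f \<Longrightarrow> e \<otimes> u \<in> L"
begin

text \<open>Each round gains one order. With \<open>y = u + z\<close>, the element
  \<open>x - e z\<close> equals \<open>y f\<close> modulo \<open>L\<close>, because
  \<open>e u \<in> L\<close>. It has order \<open>N + s\<close>, so Artin-Rees replaces
  \<open>y\<close> by a coefficient \<open>w\<close> of order \<open>N + s - A > s\<close>, and
  \<open>y - w \<in> L : f\<close>. The bound on \<open>s\<close> ensures that \<open>x\<close> also
  has order \<open>N + s\<close>.\<close>

lemma perturb_quotient_approx:
  assumes x: "x \<in> P n" and y: "y \<in> carrier R" and xy: "x \<ominus> y \<otimes> (f \<oplus> e) \<in> L"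
  shows "s \<le> Suc n - N \<Longrightarrow> y \<in> colon R L f <+>\<^bsub>R\<^esub> P s"
proof (induct s)
  case 0
  have "y = \<zero> \<oplus> y" "\<zero> \<in> colon R L f" using y ideal_zero[OF colon_ideal[OF L f]] by auto
  moreover have "y \<in> P 0" using y by (simp only: ideal_pow_0)
  ultimately show ?case unfolding set_add_mem_iff by blast
next
  case (Suc s)
  then obtain u z where uz: "u \<in> colon R L f" "z \<in> P s" "y = u \<oplus> z" by (auto simp: set_add_mem_iff)
  have carr: "x \<in> carrier R" "u \<in> carrier R" "z \<in> carrier R" "e \<in> carrier R"
    using x uz e P_carr by (auto simp: colon_iff)
  have "(x \<ominus> e \<otimes> z) \<ominus> y \<otimes> f = (x \<ominus> y \<otimes> (f \<oplus> e)) \<oplus> e \<otimes> u"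
    unfolding uz(3) using carr f by algebra
  then have *: "(x \<ominus> e \<otimes> z) \<ominus> y \<otimes> f \<in> L" using xy kill[OF uz(1)] ideal_add[OF L] by simp
  then have "x \<ominus> e \<otimes> z \<in> adjoin L f" using carr y by (intro adjoinI[OF L f]) auto
  moreover have "e \<otimes> z \<in> P (N + s)" "x \<in> P (N + s)"
    using P_mult[OF e uz(2)] subsetD[OF P_antimono x, of "N + s"] Suc.prems by auto
  then have "x \<ominus> e \<otimes> z \<in> P (N + s)" using ideal_diff[OF P_ideal] by simp
  ultimately have "x \<ominus> e \<otimes> z \<in> P (N + s - A) \<cdot> adjoin L f"
    using A unfolding artin_rees_bound_def by blast
  then obtain w where w: "w \<in> P (N + s - A)" "(x \<ominus> e \<otimes> z) \<ominus> w \<otimes> f \<in> L"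
    using adjoin_prod_mem[OF L f P_ideal] by blast
  have wc: "w \<in> carrier R" by (rule P_carr[OF w(1)])
  have "(y \<ominus> w) \<otimes> f = ((x \<ominus> e \<otimes> z) \<ominus> w \<otimes> f) \<ominus> ((x \<ominus> e \<otimes> z) \<ominus> y \<otimes> f)"
    using carr f y wc by algebra
  then have "y \<ominus> w \<in> colon R L f" using * w ideal_diff[OF L] y wc by (simp add: colon_iff)
  moreover have "Suc s \<le> N + s - A" using A(2) by arith
  then have "w \<in> P (Suc s)" using P_antimono w(1) by blast
  moreover have "y = (y \<ominus> w) \<oplus> w" using y wc by algebra
  ultimately show ?case unfolding set_add_mem_iff by blast
qed

lemma initial_ge_perturb: "initial_le (adjoin L (f \<oplus> e)) (adjoin L f)"
  unfolding initial_le_def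
proof (intro allI ballI)
  have ec: "e \<in> carrier R" using e P_carr by blast
  fix n x assume x: "x \<in> P n \<inter> adjoin L (f \<oplus> e)"
  then obtain y where y: "y \<in> carrier R" "x \<ominus> y \<otimes> (f \<oplus> e) \<in> L"
    using adjoinE[OF L] f ec by (metis IntD2 add.m_closed)
  \<comment> \<open>This order of \<open>z\<close> is just enough for
    \<open>e z \<in> P (Suc n)\<close>; for \<open>N > n\<close> it truncates to 0 and
    \<open>e \<in> P N\<close> suffices by itself.\<close>
  then obtain u z where uz: "u \<in> colon R L f" "z \<in> P (Suc n - N)" "y = u \<oplus> z"
    using perturb_quotient_approx[of x n y "Suc n - N"] x unfolding set_add_mem_iff by blast
  have carr: "x \<in> carrier R" "u \<in> carrier R" "z \<in> carrier R"
    using x uz P_carr by (auto simp: colon_iff)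
  have "(x \<ominus> e \<otimes> z) \<ominus> y \<otimes> f = (x \<ominus> y \<otimes> (f \<oplus> e)) \<oplus> e \<otimes> u"
    unfolding uz(3) using carr f ec by algebra
  then have "(x \<ominus> e \<otimes> z) \<ominus> y \<otimes> f \<in> L" using y kill[OF uz(1)] ideal_add[OF L] by simp
  then have "x \<ominus> e \<otimes> z \<in> adjoin L f" using carr ec y by (intro adjoinI[OF L f]) auto
  moreover have "x \<ominus> (x \<ominus> e \<otimes> z) = e \<otimes> z" using carr ec by algebra
  moreover have "e \<otimes> z \<in> P (Suc n)" using P_mult[OF e uz(2)] by simp
  ultimately show "\<exists>x'\<in>adjoin L f. x \<ominus> x' \<in> P (Suc n)" by metis
qed

text \<open>If \<open>y (f + e) \<in> L\<close>, the approximation applies to \<open>x = 0\<close>,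
  which has every order. So \<open>y\<close> lies in \<open>(L : f) + P s\<close> for all
  \<open>s\<close>, and \<open>L : f\<close> is closed.\<close>

lemma colon_perturb_subset: "colon R L (f \<oplus> e) \<subseteq> colon R L f"
proof
  fix y assume "y \<in> colon R L (f \<oplus> e)"
  then have y: "y \<in> carrier R" "y \<otimes> (f \<oplus> e) \<in> L" by (auto simp: colon_iff)
  have ec: "e \<in> carrier R" using e P_carr by blast
  have "\<zero> \<ominus> y \<otimes> (f \<oplus> e) = \<ominus> (y \<otimes> (f \<oplus> e))" using y f ec by algebra
  then have "\<zero> \<ominus> y \<otimes> (f \<oplus> e) \<in> L" using y(2) ideal_neg[OF L] by simp
  then have "y \<in> colon R L f <+>\<^bsub>R\<^esub> P s" for s
    using perturb_quotient_approx[of \<zero> "s + N" y s] ideal_zero[OF P_ideal] y(1) by simp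
  then show "y \<in> colon R L f" using krull_intersection[OF colon_ideal[OF L f] y(1)] by blast
qed

end

lemma kill_mem: "\<lbrakk>P n \<cdot> K \<subseteq> M; c \<in> P n; y \<in> K\<rbrakk> \<Longrightarrow> c \<otimes> y \<in> M"
  by (blast intro: ideal_prod.prod)

text \<open>The elements that carry \<open>t\<close> into \<open>M\<close> form an ideal, so testing
  the generators \<open>c d\<close> of \<open>P (a + b)\<close> is enough.\<close>

lemma P_add_kill:
  assumes M: "ideal M R" and t: "t \<in> carrier R" and e: "e \<in> P (a + b)"
    and *: "\<And>c d. \<lbrakk>c \<in> P a; d \<in> P b\<rbrakk> \<Longrightarrow> (c \<otimes> d) \<otimes> t \<in> M"
  shows "e \<otimes> t \<in> M"
proof -
  have "P (a + b) \<subseteq> colon R M t"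
    unfolding ideal_pow_add[OF J]
  proof (intro ideal_prod_minimal colon_ideal M t)
    fix c d assume "c \<in> P a" "d \<in> P b"
    then show "c \<otimes> d \<in> colon R M t" using *[of c d] P_carr[of c a] P_carr[of d b] by (simp add: colon_iff)
  qed
  then show ?thesis using e by (auto simp: colon_iff)
qed

text \<open>From \<open>y f = w g\<close> and \<open>c w = v f\<close> modulo \<open>L\<close>
  follows \<open>(c y - v g) f \<in> L\<close>. Hence a factor \<open>c \<in> P a\<close> brings
  \<open>c y - v g\<close> into \<open>L : f\<close>, which \<open>P b\<close> kills modulo
  \<open>L\<close>.\<close>

lemma colon_swap:
  assumes L: "ideal L R" and f: "f \<in> carrier R" and g: "g \<in> carrier R"
    and a: "P a \<cdot> colon R (adjoin L f) g \<subseteq> adjoin L f" and b: "P b \<cdot> colon R L f \<subseteq> L"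
  shows "P (b + a) \<cdot> colon R (adjoin L g) f \<subseteq> adjoin L g"
proof (rule ideal_prod_minimal)
  show M: "ideal (adjoin L g) R" by (rule adjoin_ideal[OF L g])
  fix e y assume e: "e \<in> P (b + a)" and "y \<in> colon R (adjoin L g) f"
  then have y: "y \<in> carrier R" "y \<otimes> f \<in> adjoin L g" by (auto simp: colon_iff)
  obtain w where w: "w \<in> carrier R" "y \<otimes> f \<ominus> w \<otimes> g \<in> L" using adjoinE[OF L g y(2)] by blast
  have "w \<otimes> g \<ominus> y \<otimes> f = \<ominus> (y \<otimes> f \<ominus> w \<otimes> g)" using y w f g by algebra
  then have "w \<otimes> g \<in> adjoin L f"
    using w y g f ideal_neg[OF L] by (intro adjoinI[OF L f, of _ y]) auto
  then have wcol: "w \<in> colon R (adjoin L f) g" using w by (simp add: colon_iff)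
  show "e \<otimes> y \<in> adjoin L g"
  proof (rule P_add_kill[OF M y(1) e])
    fix d c assume d: "d \<in> P b" and c: "c \<in> P a"
    obtain v where v: "v \<in> carrier R" "c \<otimes> w \<ominus> v \<otimes> f \<in> L"
      using adjoinE[OF L f] kill_mem[OF a c wcol] by blast
    have carr: "c \<in> carrier R" "d \<in> carrier R" using c d P_carr by auto
    have "(c \<otimes> y \<ominus> v \<otimes> g) \<otimes> f = c \<otimes> (y \<otimes> f \<ominus> w \<otimes> g) \<oplus> g \<otimes> (c \<otimes> w \<ominus> v \<otimes> f)"
      using carr y w v f g by algebra
    also have "\<dots> \<in> L" using w v carr g by (intro ideal_add[OF L] ideal_lmult[OF L])
    finally have "c \<otimes> y \<ominus> v \<otimes> g \<in> colon R L f" using carr y v g by (simp add: colon_iff)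
    then have "d \<otimes> (c \<otimes> y \<ominus> v \<otimes> g) \<in> L" by (rule kill_mem[OF b d])
    moreover have "(d \<otimes> c) \<otimes> y \<ominus> (d \<otimes> v) \<otimes> g = d \<otimes> (c \<otimes> y \<ominus> v \<otimes> g)"
      using carr y v g by algebra
    ultimately show "(d \<otimes> c) \<otimes> y \<in> adjoin L g"
      using carr y v by (intro adjoinI[OF L g, of _ "d \<otimes> v"]) auto
  qed
qed

section \<open>Doubling of the exponent of a later element\<close>

context
  fixes L f g e a b N A A'
  assumes L: "ideal L R" and f: "f \<in> carrier R" and g: "g \<in> carrier R" and e: "e \<in> P N"
    and a: "P a \<cdot> colon R (adjoin L f) g \<subseteq> adjoin L f" and b: "P b \<cdot> colon R L f \<subseteq> L"
    and N: "b + a \<le> N"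
    and A: "artin_rees_bound (adjoin L f) A" "A < N"
    and A': "artin_rees_bound (adjoin (adjoin L g) f) A'" "A' < N"
begin

lemma perturbation_carr: "e \<in> carrier R"
  using e P_carr by blast

lemma adjoin_perturb_ideal: "ideal (adjoin L (f \<oplus> e)) R"
  using f perturbation_carr by (intro adjoin_ideal[OF L]) auto

text \<open>The two factors have separate tasks: \<open>P a\<close> carries
  \<open>(L, f) : g\<close> into \<open>(L, f)\<close>, and \<open>P (N - a)\<close> carries
  \<open>L : f\<close> into \<open>L\<close> because \<open>b \<le> N - a\<close>.\<close>

lemma perturbation_prod: "e \<in> P a \<cdot> P (N - a)"
  using e N by (simp add: ideal_pow_add[OF J, symmetric])

lemma colon_base_mult: "\<lbrakk>d \<in> P (N - a); y \<in> colon R L f\<rbrakk> \<Longrightarrow> d \<otimes> y \<in> L"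
  using kill_mem[OF b] P_antimono[of b "N - a"] N by (meson add_le_imp_le_diff subsetD)

text \<open>Shaped for iteration: the error keeps the factor \<open>P (2 * a)\<close> while the
  order in \<open>L : g\<close> grows by one.\<close>

lemma colon_step:
  assumes t: "t \<in> colon R L g" "t \<in> P s" and c: "c \<in> P (2 * a)"
  shows "c \<otimes> t \<in> adjoin L (f \<oplus> e) <+>\<^bsub>R\<^esub> P (2 * a) \<cdot> (colon R L g \<inter> P (Suc s))"
    (is "_ \<in> ?M' <+>\<^bsub>R\<^esub> ?K")
proof -
  have T: "ideal (colon R L g \<inter> P (Suc s)) R" by (intro i_intersect colon_ideal L g P_ideal)
  have K: "ideal ?K R" by (rule ideal_prod_is_ideal[OF P_ideal T])
  have X: "ideal (?M' <+>\<^bsub>R\<^esub> ?K) R" by (rule add_ideals[OF adjoin_perturb_ideal K])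
  have tc: "t \<in> carrier R" "t \<otimes> g \<in> L" using t by (auto simp: colon_iff)
  have f': "f \<oplus> e \<in> carrier R" using f perturbation_carr by simp
  have "c \<in> P (a + a)" using c by (simp add: mult_2)
  then show ?thesis
  proof (rule P_add_kill[OF X tc(1)])
    \<comment> \<open>The factor \<open>c1\<close> brings \<open>t\<close> into
      \<open>(L, f)\<close>, where Artin-Rees yields the coefficient \<open>p\<close>;
      \<open>c2\<close> is held back to rebuild \<open>P (2 * a)\<close>.\<close>
    fix c2 c1 assume c2: "c2 \<in> P a" and c1: "c1 \<in> P a"
    have cc: "c1 \<in> carrier R" "c2 \<in> carrier R" using c1 c2 P_carr by auto
    have "t \<in> colon R (adjoin L f) g" using tc adjoin_subset[OF L f] by (auto simp: colon_iff)
    then have "c1 \<otimes> t \<in> P (s + a) \<inter> adjoin L f"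
      using kill_mem[OF a c1] P_mult[OF c1 t(2)] by (simp add: add.commute)
    then have "c1 \<otimes> t \<in> P (s + a - A) \<cdot> adjoin L f" using A unfolding artin_rees_bound_def by blast
    then obtain p where p: "p \<in> P (s + a - A)" "c1 \<otimes> t \<ominus> p \<otimes> f \<in> L"
      using adjoin_prod_mem[OF L f P_ideal] by blast
    have pc: "p \<in> carrier R" by (rule P_carr[OF p(1)])
    have "(p \<otimes> g) \<otimes> f = c1 \<otimes> (t \<otimes> g) \<ominus> g \<otimes> (c1 \<otimes> t \<ominus> p \<otimes> f)"
      using cc tc pc f g by algebra
    also have "\<dots> \<in> L"
      by (rule ideal_diff[OF L ideal_lmult[OF L tc(2) cc(1)] ideal_lmult[OF L p(2) g]])
    finally have pg: "p \<otimes> g \<in> colon R L f" using pc g by (simp add: colon_iff)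
    \<comment> \<open>Split \<open>e\<close> into products \<open>c3 d\<close>. The factor
      \<open>d\<close> kills \<open>p g \<in> L : f\<close>, so \<open>d p \<in> L : g\<close>, and
      it lifts the order of \<open>p\<close> beyond \<open>s\<close> since \<open>A < N\<close>. The
      factor \<open>c3\<close> joins \<open>c2\<close>.\<close>
    have "e \<otimes> (c2 \<otimes> p) \<in> ?K"
    proof -
      have "P a \<cdot> P (N - a) \<subseteq> colon R ?K (c2 \<otimes> p)"
      proof (intro ideal_prod_minimal colon_ideal K m_closed cc pc)
        fix c3 d assume c3: "c3 \<in> P a" and d: "d \<in> P (N - a)"
        have dc: "c3 \<in> carrier R" "d \<in> carrier R" using c3 d P_carr by auto
        have "d \<otimes> (p \<otimes> g) \<in> L" by (rule colon_base_mult[OF d pg])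
        then have "d \<otimes> p \<in> colon R L g" using dc pc g by (simp add: colon_iff m_assoc)
        moreover have "d \<otimes> p \<in> P (Suc s)" using P_mult[OF d p(1)] N A(2) by simp
        moreover have "c2 \<otimes> c3 \<in> P (2 * a)" using P_mult[OF c2 c3] by simp
        ultimately have "(c2 \<otimes> c3) \<otimes> (d \<otimes> p) \<in> ?K" by (blast intro: ideal_prod.prod)
        moreover have "(c3 \<otimes> d) \<otimes> (c2 \<otimes> p) = (c2 \<otimes> c3) \<otimes> (d \<otimes> p)" using dc cc pc by algebra
        ultimately show "c3 \<otimes> d \<in> colon R ?K (c2 \<otimes> p)" using dc by (simp add: colon_iff)
      qed
      then show ?thesis using perturbation_prod by (auto simp: colon_iff)
    qed
    then have k: "\<ominus> (e \<otimes> (c2 \<otimes> p)) \<in> ?K" using ideal_neg[OF K] by blast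
    have "(c2 \<otimes> (c1 \<otimes> t \<ominus> p \<otimes> f) \<oplus> (c2 \<otimes> p) \<otimes> (f \<oplus> e)) \<ominus> (c2 \<otimes> p) \<otimes> (f \<oplus> e)
        = c2 \<otimes> (c1 \<otimes> t \<ominus> p \<otimes> f)"
      using cc tc pc f perturbation_carr by algebra
    then have "c2 \<otimes> (c1 \<otimes> t \<ominus> p \<otimes> f) \<oplus> (c2 \<otimes> p) \<otimes> (f \<oplus> e) \<in> ?M'"
      using cc tc pc f perturbation_carr ideal_lmult[OF L p(2) cc(2)] by (intro adjoinI[OF L f', of _ "c2 \<otimes> p"]) auto
    moreover have "(c2 \<otimes> c1) \<otimes> t =
        (c2 \<otimes> (c1 \<otimes> t \<ominus> p \<otimes> f) \<oplus> (c2 \<otimes> p) \<otimes> (f \<oplus> e)) \<oplus> \<ominus> (e \<otimes> (c2 \<otimes> p))"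
      using cc tc pc f perturbation_carr by algebra
    ultimately show "(c2 \<otimes> c1) \<otimes> t \<in> ?M' <+>\<^bsub>R\<^esub> ?K" unfolding set_add_mem_iff using k by blast
  qed
qed

text \<open>Iterating the step puts the left side into \<open>(L, f + e) + P s\<close> for every
  \<open>s\<close>, and \<open>(L, f + e)\<close> is closed.\<close>

lemma colon_base_kill: "P (2 * a) \<cdot> colon R L g \<subseteq> adjoin L (f \<oplus> e)"
proof
  let ?M' = "adjoin L (f \<oplus> e)" and ?T = "colon R L g"
  have T: "ideal (?T \<inter> P s) R" for s by (intro i_intersect colon_ideal L g P_ideal)
  have K: "ideal (P (2 * a) \<cdot> (?T \<inter> P s)) R" for s by (rule ideal_prod_is_ideal[OF P_ideal T])
  have X: "ideal (?M' <+>\<^bsub>R\<^esub> P (2 * a) \<cdot> (?T \<inter> P s)) R" for s by (rule add_ideals[OF adjoin_perturb_ideal K])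
  have "P (2 * a) \<cdot> ?T \<subseteq> ?M' <+>\<^bsub>R\<^esub> P (2 * a) \<cdot> (?T \<inter> P s)" for s
  proof (induct s)
    case 0
    have "?T \<inter> P 0 = ?T" using ideal_subset[OF colon_ideal[OF L g]] by (auto simp only: ideal_pow_0)
    then show ?case using subset_set_add2[OF adjoin_perturb_ideal K, of 0] by simp
  next
    case (Suc s)
    have "P (2 * a) \<cdot> (?T \<inter> P s) \<subseteq> ?M' <+>\<^bsub>R\<^esub> P (2 * a) \<cdot> (?T \<inter> P (Suc s))"
      using colon_step by (intro ideal_prod_minimal X) auto
    then have "?M' <+>\<^bsub>R\<^esub> P (2 * a) \<cdot> (?T \<inter> P s) \<subseteq> ?M' <+>\<^bsub>R\<^esub> P (2 * a) \<cdot> (?T \<inter> P (Suc s))"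
      using subset_set_add1[OF adjoin_perturb_ideal K] by (intro set_add_minimal X)
    then show ?case using Suc by (rule subset_trans[rotated])
  qed
  moreover have "P (2 * a) \<cdot> (?T \<inter> P s) \<subseteq> P s" for s
    using ideal_prod_inter[OF P_ideal T] by blast
  then have "?M' <+>\<^bsub>R\<^esub> P (2 * a) \<cdot> (?T \<inter> P s) \<subseteq> ?M' <+>\<^bsub>R\<^esub> P s" for s
    using subset_set_add1[OF adjoin_perturb_ideal P_ideal] subset_set_add2[OF adjoin_perturb_ideal P_ideal]
    by (intro set_add_minimal add_ideals adjoin_perturb_ideal P_ideal) blast+
  moreover fix x assume x: "x \<in> P (2 * a) \<cdot> ?T"
  moreover have "x \<in> carrier R"
    using x ideal_prod_in_carrier[OF P_ideal colon_ideal[OF L g]] by blast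
  ultimately show "x \<in> ?M'" by (intro krull_intersection[OF adjoin_perturb_ideal]) blast+
qed

text \<open>The element \<open>y\<close> is split into \<open>w + u\<close> and a rest in
  \<open>L : g\<close>, which the preceding lemma handles. Here \<open>w\<close> solves the
  unperturbed relation \<open>z f = w g\<close> modulo \<open>L\<close>, and \<open>u\<close>
  corrects it for \<open>e\<close>, so that \<open>P a\<close> already carries \<open>w + u\<close>
  into \<open>(L, f + e)\<close>.\<close>

theorem colon_perturb_double:
  "P (2 * a) \<cdot> colon R (adjoin L (f \<oplus> e)) g \<subseteq> adjoin L (f \<oplus> e)"
proof (rule ideal_prod_minimal[OF adjoin_perturb_ideal])
  let ?M' = "adjoin L (f \<oplus> e)"
  have f': "f \<oplus> e \<in> carrier R" using f perturbation_carr by simp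
  have ec: "e \<in> carrier R" by (rule perturbation_carr)
  fix c y assume c: "c \<in> P (2 * a)" and "y \<in> colon R ?M' g"
  then have y: "y \<in> carrier R" "y \<otimes> g \<in> ?M'" by (auto simp: colon_iff)
  obtain z where z: "z \<in> carrier R" "y \<otimes> g \<ominus> z \<otimes> (f \<oplus> e) \<in> L" using adjoinE[OF L f' y(2)] by blast
  have Lg: "ideal (adjoin L g) R" by (rule adjoin_ideal[OF L g])
  have "z \<otimes> (f \<oplus> e) \<ominus> y \<otimes> g = \<ominus> (y \<otimes> g \<ominus> z \<otimes> (f \<oplus> e))" using y z f' g by algebra
  then have "z \<otimes> (f \<oplus> e) \<in> adjoin L g"
    using z f' y ideal_neg[OF L] by (intro adjoinI[OF L g, of _ y]) auto
  then have "z \<in> colon R (adjoin L g) (f \<oplus> e)" using z by (simp add: colon_iff)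
  \<comment> \<open>The colon inclusion is applied over the base \<open>(L, g)\<close>; its
    condition on \<open>e\<close> comes from exchanging \<open>f\<close> and \<open>g\<close>, at
    cost \<open>b + a \<le> N\<close>.\<close>
  moreover have "e \<otimes> u \<in> adjoin L g" if "u \<in> colon R (adjoin L g) f" for u
    using kill_mem[OF colon_swap[OF L f g a b] _ that] e P_antimono[OF N] by blast
  ultimately have "z \<in> colon R (adjoin L g) f"
    using colon_perturb_subset[OF Lg f e A'] by blast
  then obtain w where w: "w \<in> carrier R" "z \<otimes> f \<ominus> w \<otimes> g \<in> L"
    using adjoinE[OF L g] by (auto simp: colon_iff)
  have "w \<otimes> g \<ominus> z \<otimes> f = \<ominus> (z \<otimes> f \<ominus> w \<otimes> g)" using z w f g by algebra
  then have "w \<otimes> g \<in> adjoin L f"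
    using w z g ideal_neg[OF L] by (intro adjoinI[OF L f, of _ z]) auto
  then have wcol: "w \<in> colon R (adjoin L f) g" using w by (simp add: colon_iff)
  \<comment> \<open>Formally \<open>u = e w / f\<close>: from \<open>z f = w g\<close> one expects
    \<open>e z = u g\<close>, and from \<open>c w = v f\<close> one expects
    \<open>c u = e v\<close>. For a product \<open>e = c' d\<close> take \<open>u = d v'\<close>
    with \<open>c' w = v' f\<close>; the ambiguity of the division lies in \<open>L : f\<close> and
    is killed by \<open>d\<close>.\<close>
  have "\<exists>u\<in>carrier R. e \<otimes> z \<ominus> u \<otimes> g \<in> L \<and>
      (\<forall>c\<in>P a. \<forall>v\<in>carrier R. c \<otimes> w \<ominus> v \<otimes> f \<in> L \<longrightarrow> c \<otimes> u \<ominus> e \<otimes> v \<in> L)"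
    using perturbation_prod
  proof induct
    case (prod c' d)
    have cc: "c' \<in> carrier R" "d \<in> carrier R" using prod P_carr by auto
    obtain v' where v': "v' \<in> carrier R" "c' \<otimes> w \<ominus> v' \<otimes> f \<in> L"
      using adjoinE[OF L f] kill_mem[OF a prod(1) wcol] by blast
    have "(c' \<otimes> z \<ominus> v' \<otimes> g) \<otimes> f = c' \<otimes> (z \<otimes> f \<ominus> w \<otimes> g) \<oplus> g \<otimes> (c' \<otimes> w \<ominus> v' \<otimes> f)"
      using cc z w v' f g by algebra
    also have "\<dots> \<in> L" using w v' cc g by (intro ideal_add[OF L] ideal_lmult[OF L])
    finally have "c' \<otimes> z \<ominus> v' \<otimes> g \<in> colon R L f" using cc z v' g by (simp add: colon_iff)
    then have "d \<otimes> (c' \<otimes> z \<ominus> v' \<otimes> g) \<in> L" by (rule colon_base_mult[OF prod(2)])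
    moreover have "(c' \<otimes> d) \<otimes> z \<ominus> (d \<otimes> v') \<otimes> g = d \<otimes> (c' \<otimes> z \<ominus> v' \<otimes> g)"
      using cc z v' g by algebra
    moreover have "c \<otimes> (d \<otimes> v') \<ominus> (c' \<otimes> d) \<otimes> v \<in> L"
      if c: "c \<in> P a" and v: "v \<in> carrier R" "c \<otimes> w \<ominus> v \<otimes> f \<in> L" for c v
    proof -
      have c0: "c \<in> carrier R" using c P_carr by auto
      have "(c \<otimes> v' \<ominus> c' \<otimes> v) \<otimes> f = c' \<otimes> (c \<otimes> w \<ominus> v \<otimes> f) \<ominus> c \<otimes> (c' \<otimes> w \<ominus> v' \<otimes> f)"
        using cc c0 v v' w f by algebra
      also have "\<dots> \<in> L"
        by (rule ideal_diff[OF L ideal_lmult[OF L v(2) cc(1)] ideal_lmult[OF L v'(2) c0]])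
      finally have "c \<otimes> v' \<ominus> c' \<otimes> v \<in> colon R L f" using cc c0 v v' by (simp add: colon_iff)
      then have "d \<otimes> (c \<otimes> v' \<ominus> c' \<otimes> v) \<in> L" by (rule colon_base_mult[OF prod(2)])
      moreover have "c \<otimes> (d \<otimes> v') \<ominus> (c' \<otimes> d) \<otimes> v = d \<otimes> (c \<otimes> v' \<ominus> c' \<otimes> v)"
        using cc c0 v v' by algebra
      ultimately show ?thesis by simp
    qed
    ultimately show ?case using cc v' by (intro bexI[of _ "d \<otimes> v'"]) auto
  next
    case (sum e1 e2)
    then obtain u1 u2 where u: "u1 \<in> carrier R" "e1 \<otimes> z \<ominus> u1 \<otimes> g \<in> L"
      "\<And>c v. \<lbrakk>c \<in> P a; v \<in> carrier R; c \<otimes> w \<ominus> v \<otimes> f \<in> L\<rbrakk> \<Longrightarrow> c \<otimes> u1 \<ominus> e1 \<otimes> v \<in> L"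
      "u2 \<in> carrier R" "e2 \<otimes> z \<ominus> u2 \<otimes> g \<in> L"
      "\<And>c v. \<lbrakk>c \<in> P a; v \<in> carrier R; c \<otimes> w \<ominus> v \<otimes> f \<in> L\<rbrakk> \<Longrightarrow> c \<otimes> u2 \<ominus> e2 \<otimes> v \<in> L"
      by blast
    have cc: "e1 \<in> carrier R" "e2 \<in> carrier R"
      using sum(1,3) ideal_prod_in_carrier[OF P_ideal P_ideal] by blast+
    have "(e1 \<oplus> e2) \<otimes> z \<ominus> (u1 \<oplus> u2) \<otimes> g = (e1 \<otimes> z \<ominus> u1 \<otimes> g) \<oplus> (e2 \<otimes> z \<ominus> u2 \<otimes> g)"
      using cc u(1,4) z g by algebra
    moreover have "c \<otimes> (u1 \<oplus> u2) \<ominus> (e1 \<oplus> e2) \<otimes> v = (c \<otimes> u1 \<ominus> e1 \<otimes> v) \<oplus> (c \<otimes> u2 \<ominus> e2 \<otimes> v)"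
      if "c \<in> carrier R" "v \<in> carrier R" for c v using cc u(1,4) that by algebra
    ultimately show ?case
      using u P_carr by (intro bexI[of _ "u1 \<oplus> u2"]) (auto intro: ideal_add[OF L])
  qed
  then obtain u where u: "u \<in> carrier R" "e \<otimes> z \<ominus> u \<otimes> g \<in> L"
    "\<And>c v. \<lbrakk>c \<in> P a; v \<in> carrier R; c \<otimes> w \<ominus> v \<otimes> f \<in> L\<rbrakk> \<Longrightarrow> c \<otimes> u \<ominus> e \<otimes> v \<in> L" by blast
  have ca: "c \<in> P a" using c P_antimono[of a "2 * a"] by auto
  have cc: "c \<in> carrier R" by (rule P_carr[OF c])
  obtain v where v: "v \<in> carrier R" "c \<otimes> w \<ominus> v \<otimes> f \<in> L"
    using adjoinE[OF L f] kill_mem[OF a ca wcol] by blast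
  have "c \<otimes> (w \<oplus> u) \<ominus> v \<otimes> (f \<oplus> e) = (c \<otimes> w \<ominus> v \<otimes> f) \<oplus> (c \<otimes> u \<ominus> e \<otimes> v)"
    using cc w u v f ec by algebra
  then have "c \<otimes> (w \<oplus> u) \<ominus> v \<otimes> (f \<oplus> e) \<in> L" using v u(3)[OF ca v] ideal_add[OF L] by simp
  then have 1: "c \<otimes> (w \<oplus> u) \<in> ?M'" using cc w u v by (intro adjoinI[OF L f', of _ v]) auto
  have "(y \<ominus> (w \<oplus> u)) \<otimes> g
      = (y \<otimes> g \<ominus> z \<otimes> (f \<oplus> e)) \<oplus> ((z \<otimes> f \<ominus> w \<otimes> g) \<oplus> (e \<otimes> z \<ominus> u \<otimes> g))"
    using y z w u f ec g by algebra
  also have "\<dots> \<in> L" using z w u by (intro ideal_add[OF L])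
  finally have "y \<ominus> (w \<oplus> u) \<in> colon R L g" using y w u by (simp add: colon_iff)
  then have 2: "c \<otimes> (y \<ominus> (w \<oplus> u)) \<in> ?M'" using colon_base_kill c by (blast intro: ideal_prod.prod)
  have "c \<otimes> y = c \<otimes> (w \<oplus> u) \<oplus> c \<otimes> (y \<ominus> (w \<oplus> u))" using cc y w u by algebra
  then show "c \<otimes> y \<in> ?M'" using 1 2 ideal_add[OF adjoin_perturb_ideal] by simp
qed

end

end

section \<open>Perturbing a sequence\<close>

lemma seq_ideal_cong: "(\<And>i. i \<in> {1..j} \<Longrightarrow> f i = g i) \<Longrightarrow> seq_ideal R f j = seq_ideal R g j"
  unfolding seq_ideal_def by (metis (no_types, lifting) image_cong)

lemma (in ring) seq_ideal_ideal: "f ` {1..j} \<subseteq> carrier R \<Longrightarrow> ideal (seq_ideal R f j) R"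
  unfolding seq_ideal_def by (rule genideal_ideal)

context radical_adic
begin

text \<open>The \<open>k\<close>-th entry is treated as if it came last, over the ideal
  \<open>L j\<close> of the other entries up to \<open>j\<close>. Entries before \<open>k\<close>
  see no change, the exponent at \<open>k\<close> survives by the inclusion of colons, and those
  behind \<open>k\<close> double.\<close>

lemma perturb_one:
  fixes g :: "nat \<Rightarrow> 'a" and \<alpha> \<beta> :: "nat \<Rightarrow> nat" and r k N :: nat
  defines "S \<equiv> seq_ideal R g"
  assumes g: "\<And>i. i \<in> {1..r} \<Longrightarrow> g i \<in> carrier R" and k: "k \<in> {1..r}" and e: "e \<in> P N"
    and kill: "\<And>i. i \<in> {1..r} \<Longrightarrow> P (\<alpha> i) \<cdot> colon R (S (i - 1)) (g i) \<subseteq> S (i - 1)"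
    and sum: "(\<Sum>i=k..r. \<alpha> i) \<le> N"
    and AR: "\<And>j. j \<in> {1..r} \<Longrightarrow> artin_rees_bound (S j) (\<beta> j) \<and> \<beta> j < N"
  defines "g' \<equiv> g(k := g k \<oplus> e)"
  defines "S' \<equiv> seq_ideal R g'"
  shows "i \<in> {1..r} \<Longrightarrow>
      P (if k < i then 2 * \<alpha> i else \<alpha> i) \<cdot> colon R (S' (i - 1)) (g' i) \<subseteq> S' (i - 1)"
    and "j \<in> {1..r} \<Longrightarrow> initial_le (S j) (S' j)"
    and "j \<in> {1..r} \<Longrightarrow> initial_le (S' j) (S j)"
proof -
  define L where "L j = Idl (g ` ({1..j} - {k}))" for j
  have ec: "e \<in> carrier R" using e P_carr by blast
  have gk: "g k \<in> carrier R" "g k \<oplus> e \<in> carrier R" using g k ec by auto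
  have sub: "g ` ({1..j} - {k}) \<subseteq> carrier R" if "j \<le> r" for j using g that by auto
  have L: "ideal (L j) R" if "j \<le> r" for j unfolding L_def by (rule genideal_ideal[OF sub[OF that]])
  have Lf: "adjoin (L j) (g k) = S j" if "k \<le> j" "j \<le> r" for j
  proof -
    have "insert (g k) (g ` ({1..j} - {k})) = g ` {1..j}" using that k by (auto simp: image_iff)
    then show ?thesis
      unfolding L_def S_def seq_ideal_def using Idl_insert[OF sub[OF that(2)] gk(1)] by simp
  qed
  have Lf': "adjoin (L j) (g k \<oplus> e) = S' j" if "k \<le> j" "j \<le> r" for j
  proof -
    have "insert (g k \<oplus> e) (g ` ({1..j} - {k})) = g' ` {1..j}"
      using that k by (auto simp: image_iff g'_def)
    then show ?thesis
      unfolding L_def S'_def seq_ideal_def using Idl_insert[OF sub[OF that(2)] gk(2)] by simp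
  qed
  have Lg: "adjoin (L j) (g (Suc j)) = L (Suc j)" if "k \<le> j" "Suc j \<le> r" for j
  proof -
    have "insert (g (Suc j)) (g ` ({1..j} - {k})) = g ` ({1..Suc j} - {k})"
      using that k by (auto simp: image_iff le_Suc_eq)
    then show ?thesis
      unfolding L_def using Idl_insert[OF sub, of j "g (Suc j)"] g that by simp
  qed
  have Lk: "L k = S (k - 1)"
  proof -
    have "{1..k} - {k} = {1..k - 1}" using k by auto
    then show ?thesis unfolding L_def S_def seq_ideal_def by simp
  qed
  have S_less: "S' j = S j" if "j < k" for j
    unfolding S'_def S_def g'_def using that by (intro seq_ideal_cong) auto
  \<comment> \<open>Carries \<open>g k\<close> past \<open>g (k + 1), ..., g j\<close> by successive
    exchanges. The exponents add up, which is why the hypothesis on \<open>N\<close> is a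
    sum.\<close>
  have B: "P (\<Sum>i=k..j. \<alpha> i) \<cdot> colon R (L j) (g k) \<subseteq> L j" if "k \<le> j" "j \<le> r" for j
    using that
  proof (induct j rule: dec_induct)
    case base
    then show ?case using kill[OF k] by (simp add: Lk)
  next
    case (step j)
    have j: "k \<le> j" "Suc j \<le> r" "j \<le> r" using step by auto
    have "P (\<alpha> (Suc j)) \<cdot> colon R (adjoin (L j) (g k)) (g (Suc j)) \<subseteq> adjoin (L j) (g k)"
      using kill[of "Suc j"] j by (simp add: Lf)
    then have "P ((\<Sum>i=k..j. \<alpha> i) + \<alpha> (Suc j)) \<cdot> colon R (adjoin (L j) (g (Suc j))) (g k)
        \<subseteq> adjoin (L j) (g (Suc j))"
      using step j g by (intro colon_swap L gk) auto
    then show ?case using j by (simp add: Lg)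
  qed
  have le_N: "(\<Sum>i=k..j. \<alpha> i) \<le> N" if "j \<le> r" for j
    using sum_mono2[of "{k..r}" "{k..j}" \<alpha>] that sum by force
  have e_kill: "e \<otimes> u \<in> L j" if "k \<le> j" "j \<le> r" "u \<in> colon R (L j) (g k)" for j u
    using kill_mem[OF B[OF that(1,2)] _ that(3)] e P_antimono[OF le_N[OF that(2)]] by blast
  have ARL: "artin_rees_bound (adjoin (L j) (g k)) (\<beta> j)" "\<beta> j < N" if "k \<le> j" "j \<le> r" for j
    using AR[of j] k that by (auto simp: Lf)
  {
    assume j: "j \<in> {1..r}"
    have S: "ideal (S j) R" unfolding S_def using g j by (intro seq_ideal_ideal) auto
    show "initial_le (S j) (S' j)"
    proof (cases "j < k")
      case True
      then show ?thesis using S_less initial_le_refl[OF S] by simp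
    next
      case False
      then have kj: "k \<le> j" "j \<le> r" using j by auto
      show ?thesis
        using initial_le_perturb[OF L[OF kj(2)] gk(1) e ARL[OF kj]] by (simp add: Lf[OF kj] Lf'[OF kj])
    qed
    show "initial_le (S' j) (S j)"
    proof (cases "j < k")
      case True
      then show ?thesis using S_less initial_le_refl[OF S] by simp
    next
      case False
      then have kj: "k \<le> j" "j \<le> r" using j by auto
      show ?thesis
        using initial_ge_perturb[OF L[OF kj(2)] gk(1) e ARL[OF kj] e_kill[OF kj]]
        by (simp add: Lf[OF kj] Lf'[OF kj])
    qed
  next
    assume i: "i \<in> {1..r}"
    consider "i < k" | "i = k" | j where "i = Suc j" "k \<le> j" by (cases i) fastforce+
    then show "P (if k < i then 2 * \<alpha> i else \<alpha> i) \<cdot> colon R (S' (i - 1)) (g' i) \<subseteq> S' (i - 1)"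
    proof cases
      case 1
      then show ?thesis using kill[OF i] S_less[of "i - 1"] by (simp add: g'_def)
    next
      case 2
      have kr: "k \<le> k" "k \<le> r" using k by auto
      have "colon R (S (k - 1)) (g k \<oplus> e) \<subseteq> colon R (S (k - 1)) (g k)"
        using colon_perturb_subset[OF L[OF kr(2)] gk(1) e ARL[OF kr] e_kill[OF kr]] by (simp only: Lk)
      then have "P (\<alpha> k) \<cdot> colon R (S (k - 1)) (g k \<oplus> e) \<subseteq> S (k - 1)"
        using kill[OF k] ideal_prod_mono[of "P (\<alpha> k)" "P (\<alpha> k)"] by blast
      then show ?thesis using 2 k S_less[of "k - 1"] by (auto simp: g'_def)
    next
      case (3 j)
      have j: "k \<le> j" "j \<le> r" "Suc j \<le> r" "k \<le> Suc j" using 3 i by auto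
      have gi: "g (Suc j) \<in> carrier R" using g i 3 by simp
      have a: "P (\<alpha> i) \<cdot> colon R (adjoin (L j) (g k)) (g (Suc j)) \<subseteq> adjoin (L j) (g k)"
        using kill[OF i] 3 by (simp add: Lf j)
      have le: "(\<Sum>i=k..j. \<alpha> i) + \<alpha> i \<le> N" using le_N[OF j(3)] j 3 by simp
      have "artin_rees_bound (adjoin (adjoin (L j) (g (Suc j))) (g k)) (\<beta> (Suc j))"
        using ARL(1)[OF j(4,3)] by (simp add: Lg j)
      then show ?thesis
        using colon_perturb_double[OF L[OF j(2)] gk(1) gi e a B[OF j(1,2)] le ARL[OF j(1,2)] _ ARL(2)[OF j(4,3)]]
          3 j by (simp add: Lf' g'_def)
    qed
  }
qed

text \<open>The elements are perturbed from the last to the first. Perturbing the \<open>k\<close>-th one doubles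
  the exponents behind it, and the exponents in front of it are still the original ones.\<close>

lemma perturb_all:
  fixes f \<epsilon> :: "nat \<Rightarrow> 'a" and a \<beta> :: "nat \<Rightarrow> nat" and r k N :: nat
  assumes f: "\<And>i. i \<in> {1..r} \<Longrightarrow> f i \<in> carrier R" and \<epsilon>: "\<And>i. i \<in> {1..r} \<Longrightarrow> \<epsilon> i \<in> P N"
    and kill: "\<And>i. i \<in> {1..r} \<Longrightarrow>
      P (a i) \<cdot> colon R (seq_ideal R f (i - 1)) (f i) \<subseteq> seq_ideal R f (i - 1)"
    and sum: "(\<Sum>i=1..r. 2 ^ (i - 2) * a i) \<le> N"
    and AR: "\<And>j. j \<in> {1..r} \<Longrightarrow> artin_rees_exact (seq_ideal R f j) (\<beta> j) \<and> \<beta> j < N"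
    and "k \<le> r"
  defines "g \<equiv> \<lambda>k i. if i \<le> k then f i else f i \<oplus> \<epsilon> i"
  shows "(\<forall>i\<in>{1..r}. P (if k < i then 2 ^ (i - k - 1) * a i else a i)
          \<cdot> colon R (seq_ideal R (g k) (i - 1)) (g k i) \<subseteq> seq_ideal R (g k) (i - 1)) \<and>
    (\<forall>j\<in>{1..r}. initial_le (seq_ideal R f j) (seq_ideal R (g k) j) \<and>
      initial_le (seq_ideal R (g k) j) (seq_ideal R f j))"
  using \<open>k \<le> r\<close>
proof (induct k rule: inc_induct)
  case base
  have S: "seq_ideal R (g r) j = seq_ideal R f j" if "j \<le> r" for j
    using that by (intro seq_ideal_cong) (auto simp: g_def)
  have I: "ideal (seq_ideal R f j) R" if "j \<in> {1..r}" for j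
    using f that by (intro seq_ideal_ideal) auto
  show ?case
  proof (intro conjI ballI)
    fix i assume i: "i \<in> {1..r}"
    then have "seq_ideal R (g r) (i - 1) = seq_ideal R f (i - 1)" "g r i = f i"
      using S[of "i - 1"] by (auto simp: g_def)
    then show "P (if r < i then 2 ^ (i - r - 1) * a i else a i)
        \<cdot> colon R (seq_ideal R (g r) (i - 1)) (g r i) \<subseteq> seq_ideal R (g r) (i - 1)"
      using kill[OF i] i by simp
  next
    fix j assume j: "j \<in> {1..r}"
    show "initial_le (seq_ideal R f j) (seq_ideal R (g r) j)"
      "initial_le (seq_ideal R (g r) j) (seq_ideal R f j)"
      using S[of j] j initial_le_refl[OF I[OF j]] by simp_all
  qed
next
  case (step k)
  let ?g = "g (Suc k)"
  define \<alpha> where "\<alpha> i = (if Suc k < i then 2 ^ (i - Suc k - 1) * a i else a i)" for i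
  have kr: "Suc k \<in> {1..r}" using step by simp
  have gc: "g k i \<in> carrier R" if "i \<in> {1..r}" for k i
    using f[OF that] P_carr[OF \<epsilon>[OF that]] by (simp add: g_def)
  have g': "?g(Suc k := ?g (Suc k) \<oplus> \<epsilon> (Suc k)) = g k" by (auto simp: g_def fun_eq_iff)
  have fS: "ideal (seq_ideal R f j) R" if "j \<in> {1..r}" for j using f that by (intro seq_ideal_ideal) auto
  have gS: "ideal (seq_ideal R (g k) j) R" if "j \<in> {1..r}" for k j
    using gc that by (intro seq_ideal_ideal) auto
  have kill': "P (\<alpha> i) \<cdot> colon R (seq_ideal R ?g (i - 1)) (?g i) \<subseteq> seq_ideal R ?g (i - 1)"
    if "i \<in> {1..r}" for i using step(3) that unfolding \<alpha>_def by blast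
  \<comment> \<open>The current ideals have the initial ideals of the original ones, so the original
    Artin-Rees exponents remain valid.\<close>
  have AR': "artin_rees_bound (seq_ideal R ?g j) (\<beta> j) \<and> \<beta> j < N" if j: "j \<in> {1..r}" for j
    using initial_le_artin_rees_exact[OF fS[OF j] gS[OF j], of "Suc k" "\<beta> j"] step(3) AR[OF j] j
      artin_rees_exact_imp_bound[OF _ gS[OF j]] by blast
  \<comment> \<open>Equality holds for all \<open>i \<ge> 1\<close> when \<open>k = 0\<close>: the
    last perturbation performed dictates the weights. Truncation gives weight 1 both for
    \<open>i = 1\<close> and for \<open>i = 2\<close>.\<close>
  have "\<alpha> i \<le> 2 ^ (i - 2) * a i" for i
    by (auto simp: \<alpha>_def intro!: power_increasing)
  then have "(\<Sum>i=Suc k..r. \<alpha> i) \<le> (\<Sum>i=Suc k..r. 2 ^ (i - 2) * a i)" by (intro sum_mono)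
  also have "\<dots> \<le> (\<Sum>i=1..r. 2 ^ (i - 2) * a i)" by (intro sum_mono2) auto
  finally have sum': "(\<Sum>i=Suc k..r. \<alpha> i) \<le> N" using sum by simp
  note * = perturb_one[OF gc kr \<epsilon>[OF kr] kill' sum' AR', unfolded g']
  have eq: "(if Suc k < i then 2 * \<alpha> i else \<alpha> i) = (if k < i then 2 ^ (i - k - 1) * a i else a i)" for i
  proof (cases "Suc k < i")
    case True
    then obtain m where "i = Suc (Suc (k + m))" by (metis add_Suc less_imp_Suc_add)
    then show ?thesis by (simp add: \<alpha>_def)
  next
    case False
    then show ?thesis by (cases "i = Suc k") (auto simp: \<alpha>_def)
  qed
  have "P (if k < i then 2 ^ (i - k - 1) * a i else a i)
          \<cdot> colon R (seq_ideal R (g k) (i - 1)) (g k i) \<subseteq> seq_ideal R (g k) (i - 1)"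
    if "i \<in> {1..r}" for i
    by (rule *(1)[unfolded eq]) (assumption | rule that)+
  moreover have **: "initial_le (seq_ideal R ?g j) (seq_ideal R (g k) j)"
    "initial_le (seq_ideal R (g k) j) (seq_ideal R ?g j)" if "j \<in> {1..r}" for j
    by (rule *(2,3); (assumption | rule that))+
  have "initial_le (seq_ideal R f j) (seq_ideal R (g k) j) \<and>
      initial_le (seq_ideal R (g k) j) (seq_ideal R f j)" if j: "j \<in> {1..r}" for j
    using initial_le_trans[OF _ **(1)[OF j] gS[OF j] gS[OF j]]
      initial_le_trans[OF **(2)[OF j] _ gS[OF j] fS[OF j]] step(3) j by blast
  ultimately show ?case by blast
qed

end

section \<open>Loewy lengths and filter regularity\<close>

lemma Inf_enat_Collect:
  assumes "\<exists>n. Q n"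
  shows "Inf (enat ` {n. Q n}) = enat (LEAST n. Q n)"
proof -
  have "enat (LEAST n. Q n) \<in> enat ` {n. Q n}" using assms LeastI_ex by blast
  then show ?thesis
    by (intro antisym Inf_lower Inf_greatest) (auto intro: Least_le)
qed

context radical_adic
begin

section \<open>Cosets, Loewy lengths and Artin-Rees numbers\<close>

lemma rcos_eq_iff: "\<lbrakk>ideal K R; x \<in> carrier R\<rbrakk> \<Longrightarrow> K +> x = K \<longleftrightarrow> x \<in> K"
  using a_rcos_zero[of K x] ideal.rcos_const_imp_mem[of K R x] by (intro iffI)

lemma rcos_rep_mem: "\<lbrakk>ideal K R; x \<in> carrier R\<rbrakk> \<Longrightarrow> x \<in> K +> x"
  by (simp add: abelian_subgroup.a_rcos_self abelian_subgroupI3 ideal.axioms(1) is_abelian_group)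

lemma rcos_diff:
  assumes K: "ideal K R" and x: "x \<in> carrier R" and y: "y \<in> K +> x"
  shows "y \<in> carrier R" "y \<ominus> x \<in> K"
proof -
  obtain h where h: "h \<in> K" "y = h \<oplus> x" using y by (auto simp: a_r_coset_def')
  have hc: "h \<in> carrier R" by (rule ideal.Icarr[OF K h(1)])
  show "y \<in> carrier R" using h hc x by simp
  have "h \<oplus> x \<ominus> x = h" using hc x by algebra
  then show "y \<ominus> x \<in> K" using h by simp
qed

lemma rcos_eqI:
  "\<lbrakk>ideal K R; x \<in> carrier R; y \<in> carrier R; x \<ominus> y \<in> K\<rbrakk> \<Longrightarrow> K +> x = K +> y"
  by (rule iffD1[OF quotient_eq_iff_same_a_r_cos])

text \<open>The scalar action is a union over all representatives; they yield one and the same coset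
  because their differences stay in \<open>K\<close>.\<close>

lemma smult_subquot:
  assumes K: "ideal K R" and r: "r \<in> carrier R" and x: "x \<in> carrier R"
  shows "r \<odot>\<^bsub>subquot R I K\<^esub> (K +> x) = K +> (r \<otimes> x)"
proof -
  have "K +> (r \<otimes> y) = K +> (r \<otimes> x)" if "y \<in> K +> x" for y
  proof -
    note y = rcos_diff[OF K x that]
    have "r \<otimes> y \<ominus> r \<otimes> x = r \<otimes> (y \<ominus> x)" using r x y(1) by algebra
    then have "r \<otimes> y \<ominus> r \<otimes> x \<in> K" using ideal_lmult[OF K y(2) r] by simp
    then show ?thesis using r x y(1) by (intro rcos_eqI[OF K]) auto
  qed
  then have "(\<Union>y\<in>K +> x. K +> (r \<otimes> y)) = (\<Union>y\<in>K +> x. K +> (r \<otimes> x))" by (intro SUP_cong refl)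
  also have "\<dots> = K +> (r \<otimes> x)" using rcos_rep_mem[OF K x] by blast
  finally show ?thesis by (simp add: subquot_def)
qed

lemma ideal_smult_subquot_iff:
  assumes I: "ideal I R" and K: "ideal K R"
  shows "ideal_smult (P n) (subquot R I K) = {\<zero>\<^bsub>subquot R I K\<^esub>} \<longleftrightarrow> P n \<cdot> I \<subseteq> K"
proof -
  have z: "\<zero>\<^bsub>subquot R I K\<^esub> = K" by (simp add: subquot_def)
  have mem: "c \<odot>\<^bsub>subquot R I K\<^esub> (K +> x) \<in> ideal_smult (P n) (subquot R I K)"
    if "c \<in> P n" "x \<in> I" for c x
    using that by (intro ideal_smult.smult) (auto simp: subquot_def)
  have sm: "c \<odot>\<^bsub>subquot R I K\<^esub> (K +> x) = K +> (c \<otimes> x)" if "c \<in> P n" "x \<in> I" for c x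
    using smult_subquot[OF K P_carr[OF that(1)] ideal.Icarr[OF I that(2)]] .
  show ?thesis unfolding z
  proof
    assume *: "ideal_smult (P n) (subquot R I K) = {K}"
    show "P n \<cdot> I \<subseteq> K"
    proof (rule ideal_prod_minimal[OF K])
      fix c x assume cx: "c \<in> P n" "x \<in> I"
      then have "K +> (c \<otimes> x) = K" using mem sm * by auto
      then show "c \<otimes> x \<in> K" using rcos_eq_iff[OF K] P_carr[OF cx(1)] ideal.Icarr[OF I cx(2)] by simp
    qed
  next
    assume *: "P n \<cdot> I \<subseteq> K"
    have sm': "c \<odot>\<^bsub>subquot R I K\<^esub> (K +> x) = K" if "c \<in> P n" "x \<in> I" for c x
      using sm[OF that] a_rcos_zero[OF K kill_mem[OF * that]] by simp
    have "C = K" if "C \<in> ideal_smult (P n) (subquot R I K)" for C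
      using that
    proof induct
      case (smult c C)
      then show ?case using sm' by (auto simp: subquot_def)
    next
      case (sum s t)
      have "K <+>\<^bsub>R\<^esub> K = K"
        using ideal.a_rcos_sum[OF K zero_closed zero_closed] a_rcos_zero[OF K ideal_zero[OF K]] by simp
      then show ?case using sum by (simp add: subquot_def)
    qed
    \<comment> \<open>The zero coset must be exhibited, since \<open>ideal_smult\<close> is
      generated by products and sums only.\<close>
    moreover have "K \<in> ideal_smult (P n) (subquot R I K)"
      using mem sm' ideal_zero[OF P_ideal] ideal_zero[OF I] by metis
    ultimately show "ideal_smult (P n) (subquot R I K) = {K}" by blast
  qed
qed

lemma loewy_length_subquot:
  assumes "ideal I R" "ideal K R"
  shows "loewy_length R J (subquot R I K) = Inf (enat ` {n. P n \<cdot> I \<subseteq> K})"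
  unfolding loewy_length_def using ideal_smult_subquot_iff[OF assms] by simp

lemma loewy_length_subquot_le:
  assumes "ideal I R" "ideal K R" "P n \<cdot> I \<subseteq> K"
  shows "loewy_length R J (subquot R I K) \<le> enat n"
  using assms by (simp add: loewy_length_subquot Inf_lower)

lemma loewy_length_subquot_attained:
  assumes "ideal I R" "ideal K R" "\<exists>n. P n \<cdot> I \<subseteq> K"
  obtains n where "loewy_length R J (subquot R I K) = enat n" "P n \<cdot> I \<subseteq> K"
proof (rule that)
  show "loewy_length R J (subquot R I K) = enat (LEAST n. P n \<cdot> I \<subseteq> K)"
    unfolding loewy_length_subquot[OF assms(1,2)] by (rule Inf_enat_Collect[OF assms(3)])
  show "P (LEAST n. P n \<cdot> I \<subseteq> K) \<cdot> I \<subseteq> K" by (rule LeastI_ex[OF assms(3)])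
qed

lemma artin_rees_number_eq: "artin_rees_number R J I = Inf (enat ` {c. artin_rees_exact I c})"
  unfolding artin_rees_number_def artin_rees_exact_def ..

lemma artin_rees_number_attained:
  assumes "ideal I R"
  obtains c where "artin_rees_number R J I = enat c" "artin_rees_exact I c"
proof (rule that)
  show "artin_rees_number R J I = enat (LEAST c. artin_rees_exact I c)"
    unfolding artin_rees_number_eq by (rule Inf_enat_Collect[OF artin_rees_exact_ex[OF assms]])
  show "artin_rees_exact I (LEAST c. artin_rees_exact I c)"
    by (rule LeastI_ex[OF artin_rees_exact_ex[OF assms]])
qed

section \<open>Associated primes and filter regularity\<close>

lemma associated_primes_quotient:
  assumes K: "ideal K R"
  shows "associated_primes R (subquot R (carrier R) K) =
    {Q. primeideal Q R \<and> (\<exists>x\<in>carrier R. Q = colon R K x)}"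
proof -
  have "{r \<in> carrier R. r \<odot>\<^bsub>subquot R (carrier R) K\<^esub> (K +> x) = \<zero>\<^bsub>subquot R (carrier R) K\<^esub>} = colon R K x"
    if x: "x \<in> carrier R" for x
  proof -
    have "\<zero>\<^bsub>subquot R (carrier R) K\<^esub> = K" by (simp add: subquot_def)
    moreover have "r \<odot>\<^bsub>subquot R (carrier R) K\<^esub> (K +> x) = K \<longleftrightarrow> r \<otimes> x \<in> K"
      if r: "r \<in> carrier R" for r
      unfolding smult_subquot[OF K r x] using r x by (intro rcos_eq_iff[OF K]) simp
    ultimately show ?thesis unfolding colon_def by auto
  qed
  moreover have "carrier (subquot R (carrier R) K) = {K +> x | x. x \<in> carrier R}"
    by (simp add: subquot_def)
  ultimately show ?thesis unfolding associated_primes_def by auto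
qed

lemma killed_elements_ideal:
  assumes K: "ideal K R"
  shows "ideal {x \<in> carrier R. \<forall>c\<in>P n. c \<otimes> x \<in> K} R"
proof -
  have "{x \<in> carrier R. \<forall>c\<in>P n. c \<otimes> x \<in> K} = \<Inter>(colon R K ` P n)"
    using P_carr m_comm ideal_zero[OF P_ideal] by (fastforce simp: colon_def)
  also have "ideal \<dots> R"
    using ideal_zero[OF P_ideal] colon_ideal[OF K] P_carr by (intro i_Intersect) blast+
  finally show ?thesis .
qed

text \<open>Among the annihilators modulo \<open>K\<close> of the elements of \<open>K : f\<close> that no power of \<open>J\<close> sends
  into \<open>K\<close>, a maximal one is prime.\<close>

lemma filter_regular_element_imp_kill:
  assumes K: "ideal K R" and f: "f \<in> carrier R"
    and fr: "\<And>x. \<lbrakk>x \<in> carrier R; primeideal (colon R K x) R; \<not> J \<subseteq> colon R K x\<rbrakk> \<Longrightarrow> f \<notin> colon R K x"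
  shows "\<exists>n. P n \<cdot> colon R K f \<subseteq> K"
proof -
  \<comment> \<open>The union of the \<open>C n\<close> is the \<open>J\<close>-torsion of
    \<open>R / K\<close>, pulled back to \<open>R\<close>; the chain condition yields one exponent
    \<open>m\<close> for all of it.\<close>
  define C where "C n = {x \<in> carrier R. \<forall>c\<in>P n. c \<otimes> x \<in> K}" for n
  have "ideal (C n) R" for n unfolding C_def by (rule killed_elements_ideal[OF K])
  moreover have "C n \<subseteq> C (Suc n)" for n unfolding C_def using P_antimono[of n "Suc n"] by auto
  ultimately obtain m where m: "(\<Union>n. C n) = C m" using ascending_ideals_stable[of C] by blast
  have "colon R K f \<subseteq> C m"
  proof (rule ccontr)
    assume "\<not> colon R K f \<subseteq> C m"
    then obtain y0 where y0: "y0 \<in> colon R K f" "y0 \<notin> C m" by blast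
    define F where "F = {colon R K y | y. y \<in> colon R K f \<and> y \<notin> C m}"
    have fam: "D \<in> F \<Longrightarrow> ideal D R" for D
      unfolding F_def using colon_ideal[OF K] by (auto simp: colon_iff)
    have "\<exists>M\<in>F. \<forall>D\<in>F. M \<subseteq> D \<longrightarrow> D = M"
    proof (rule subset_Zorn_nonempty)
      show "F \<noteq> {}" using y0 by (auto simp: F_def)
      fix Ch assume Ch: "Ch \<noteq> {}" "subset.chain F Ch"
      then have "subset.chain {I. ideal I R} Ch" using fam by (auto simp: pred_on.chain_def)
      then have "\<Union>Ch \<in> Ch" by (rule ideal_chain_is_trivial[OF Ch(1)])
      then show "\<Union>Ch \<in> F" using Ch(2) by (auto simp: pred_on.chain_def)
    qed
    then obtain y where y: "y \<in> colon R K f" "y \<notin> C m"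
      and max: "\<And>z. \<lbrakk>z \<in> colon R K f; z \<notin> C m; colon R K y \<subseteq> colon R K z\<rbrakk> \<Longrightarrow> colon R K z = colon R K y"
      unfolding F_def by blast
    have yc: "y \<in> carrier R" "y \<otimes> f \<in> K" using y by (auto simp: colon_iff)
    have bigger: "colon R K (a \<otimes> y) = colon R K y" if a: "a \<in> carrier R" "a \<otimes> y \<notin> C m" for a
    proof (rule max)
      show "a \<otimes> y \<in> colon R K f" using ideal_lmult[OF colon_ideal[OF K f] y(1) a(1)] .
      show "colon R K y \<subseteq> colon R K (a \<otimes> y)"
      proof
        fix b assume "b \<in> colon R K y"
        then have b: "b \<in> carrier R" "b \<otimes> y \<in> K" by (auto simp: colon_iff)
        have "b \<otimes> (a \<otimes> y) = a \<otimes> (b \<otimes> y)" using a b yc by algebra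
        then show "b \<in> colon R K (a \<otimes> y)" using b a ideal_lmult[OF K b(2) a(1)] by (simp add: colon_iff)
      qed
    qed (rule a(2))
    have "primeideal (colon R K y) R"
    proof (rule primeidealI[OF colon_ideal[OF K yc(1)] cring_axioms])
      have "y \<notin> K" using y(2) yc(1) ideal_lmult[OF K] P_carr by (auto simp: C_def)
      then have "\<one> \<notin> colon R K y" using yc by (simp add: colon_iff)
      then show "carrier R \<noteq> colon R K y" by blast
      fix a b assume ab: "a \<in> carrier R" "b \<in> carrier R" "a \<otimes> b \<in> colon R K y"
      show "a \<in> colon R K y \<or> b \<in> colon R K y"
      proof (cases "b \<otimes> y \<in> C m")
        case False
        have "a \<in> colon R K (b \<otimes> y)" using ab yc by (simp add: colon_iff m_assoc)
        then show ?thesis using bigger[OF ab(2) False] by simp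
      next
        case True
        \<comment> \<open>If \<open>b y\<close> is torsion, \<open>y\<close> is replaced by a
          multiple \<open>j y\<close> that is not torsion but is killed by \<open>b\<close>. Without
          such \<open>j\<close> the power \<open>P (m + m)\<close> would carry \<open>y\<close> into
          \<open>K\<close>.\<close>
        have "\<exists>j\<in>P m. j \<otimes> y \<notin> C m"
        proof (rule ccontr)
          assume "\<not> (\<exists>j\<in>P m. j \<otimes> y \<notin> C m)"
          then have "c \<otimes> (d \<otimes> y) \<in> K" if "c \<in> P m" "d \<in> P m" for c d using that by (auto simp: C_def)
          then have "e \<otimes> y \<in> K" if "e \<in> P (m + m)" for e
            using P_carr yc by (intro P_add_kill[OF K yc(1) that]) (simp add: m_assoc)
          then have "y \<in> C (m + m)" using yc by (simp add: C_def)
          then show False using y(2) m by blast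
        qed
        then obtain j where j: "j \<in> P m" "j \<otimes> y \<notin> C m" by blast
        have jc: "j \<in> carrier R" by (rule P_carr[OF j(1)])
        have "b \<otimes> (j \<otimes> y) = j \<otimes> (b \<otimes> y)" using ab jc yc by algebra
        then have "b \<otimes> (j \<otimes> y) \<in> K" using True j(1) by (simp add: C_def)
        then show ?thesis using bigger[OF jc j(2)] ab(2) by (auto simp: colon_iff)
      qed
    qed
    moreover have "\<not> J \<subseteq> colon R K y"
    proof
      assume "J \<subseteq> colon R K y"
      then have "y \<in> C (Suc 0)" using yc by (auto simp: C_def ideal_pow_1[OF J] colon_iff)
      then show False using y(2) m by blast
    qed
    ultimately have "f \<notin> colon R K y" by (rule fr[OF yc(1)])
    then show False using yc f by (simp add: colon_iff m_comm)
  qed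
  then have "P m \<cdot> colon R K f \<subseteq> K" by (intro ideal_prod_minimal[OF K]) (auto simp: C_def)
  then show ?thesis by blast
qed

text \<open>\<open>f \<in> K : x\<close> means \<open>x \<in> K : f\<close>, so a power of
  \<open>J\<close> would lie in the prime \<open>K : x\<close>, and then \<open>J\<close>
  itself.\<close>

lemma kill_imp_filter_regular_element:
  assumes K: "ideal K R" and f: "f \<in> carrier R" and n: "P n \<cdot> colon R K f \<subseteq> K"
    and x: "x \<in> carrier R" and Q: "primeideal (colon R K x) R" and JQ: "\<not> J \<subseteq> colon R K x"
  shows "f \<notin> colon R K x"
proof
  assume "f \<in> colon R K x"
  then have "x \<in> colon R K f" using x f by (simp add: colon_iff m_comm)
  then have "P n \<subseteq> colon R K x" using kill_mem[OF n] P_carr by (auto simp: colon_iff)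
  moreover obtain j where j: "j \<in> J" "j \<notin> colon R K x" using JQ by blast
  have jc: "j \<in> carrier R" by (rule ideal.Icarr[OF J j(1)])
  have "\<not> P n \<subseteq> colon R K x"
  proof (induct n)
    case 0
    then show ?case
      using primeideal.I_notcarr[OF Q] by (simp add: ideal_pow_0) (auto simp: colon_def)
  next
    case (Suc n)
    then obtain p where p: "p \<in> P n" "p \<notin> colon R K x" by blast
    have "p \<otimes> j \<in> P (Suc n)" unfolding ideal_pow_Suc using p(1) j(1) by (rule ideal_prod.prod)
    moreover have "p \<otimes> j \<notin> colon R K x"
      using primeideal.I_prime[OF Q P_carr[OF p(1)] jc] p j by blast
    ultimately show ?case by blast
  qed
  ultimately show False by blast
qed

lemma filter_regular_iff:
  "filter_regular R J f r \<longleftrightarrow>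
    (\<forall>i\<in>{1..r}. f i \<in> carrier R \<and>
      (\<exists>n. P n \<cdot> colon R (seq_ideal R f (i - 1)) (f i) \<subseteq> seq_ideal R f (i - 1)))"
proof -
  have "(\<forall>Q\<in>associated_primes R (subquot R (carrier R) (seq_ideal R f (i - 1))). \<not> J \<subseteq> Q \<longrightarrow> f i \<notin> Q)
      \<longleftrightarrow> (\<exists>n. P n \<cdot> colon R (seq_ideal R f (i - 1)) (f i) \<subseteq> seq_ideal R f (i - 1))"
    if f: "\<And>i. i \<in> {1..r} \<Longrightarrow> f i \<in> carrier R" and i: "i \<in> {1..r}" for i
  proof -
    have K: "ideal (seq_ideal R f (i - 1)) R" using f i by (intro seq_ideal_ideal) auto
    show ?thesis
      unfolding associated_primes_quotient[OF K]
      using filter_regular_element_imp_kill[OF K f[OF i]] kill_imp_filter_regular_element[OF K f[OF i]]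
      by blast
  qed
  then show ?thesis unfolding filter_regular_def by blast
qed

end

section \<open>Associated graded rings\<close>

context radical_adic
begin

lemma gr_comp_simps:
  "carrier (gr_comp R F n) = {F (Suc n) +> x | x. x \<in> F n}"
  "C \<oplus>\<^bsub>gr_comp R F n\<^esub> D = C <+>\<^bsub>R\<^esub> D"
  "\<zero>\<^bsub>gr_comp R F n\<^esub> = F (Suc n)"
  by (simp_all add: gr_comp_def subquot_def)

text \<open>The graded product is a finite sum inside a component, and the laws of such sums need
  this structure.\<close>

lemma gr_comp_abelian_monoid:
  assumes F: "ideal (F n) R" and F': "ideal (F (Suc n)) R"
  shows "abelian_monoid (gr_comp R F n)"
proof (rule abelian_monoidI)
  let ?M = "gr_comp R F n" and ?K = "F (Suc n)"
  have carr: "carrier ?M = {?K +> x | x. x \<in> F n}" and add: "x \<oplus>\<^bsub>?M\<^esub> y = x <+>\<^bsub>R\<^esub> y"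
    and zero: "\<zero>\<^bsub>?M\<^esub> = ?K" for x y
    by (simp_all add: gr_comp_simps)
  have sum: "(?K +> x) <+>\<^bsub>R\<^esub> (?K +> y) = ?K +> (x \<oplus> y)" if "x \<in> F n" "y \<in> F n" for x y
    using that by (intro ideal.a_rcos_sum[OF F'] ideal.Icarr[OF F])
  note Fc = ideal.Icarr[OF F]
  show "x \<oplus>\<^bsub>?M\<^esub> y \<in> carrier ?M" if "x \<in> carrier ?M" "y \<in> carrier ?M" for x y
    using that sum ideal_add[OF F] by (auto simp: carr add)
  show "\<zero>\<^bsub>?M\<^esub> \<in> carrier ?M"
    using a_rcos_zero[OF F' ideal_zero[OF F']] ideal_zero[OF F] by (auto simp: carr zero)
  show "(x \<oplus>\<^bsub>?M\<^esub> y) \<oplus>\<^bsub>?M\<^esub> z = x \<oplus>\<^bsub>?M\<^esub> (y \<oplus>\<^bsub>?M\<^esub> z)"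
    if xyz: "x \<in> carrier ?M" "y \<in> carrier ?M" "z \<in> carrier ?M" for x y z
  proof -
    obtain u v w where u: "u \<in> F n" "v \<in> F n" "w \<in> F n" "x = ?K +> u" "y = ?K +> v" "z = ?K +> w"
      using xyz by (auto simp: carr)
    then show ?thesis using Fc by (simp add: add sum ideal_add[OF F] a_assoc)
  qed
  show "\<zero>\<^bsub>?M\<^esub> \<oplus>\<^bsub>?M\<^esub> x = x" if x: "x \<in> carrier ?M" for x
  proof -
    obtain u where u: "u \<in> F n" "x = ?K +> u" using x by (auto simp: carr)
    have "?K <+>\<^bsub>R\<^esub> (?K +> u) = (?K +> \<zero>) <+>\<^bsub>R\<^esub> (?K +> u)"
      using a_rcos_zero[OF F' ideal_zero[OF F']] by simp
    also have "\<dots> = ?K +> u" using sum[OF ideal_zero[OF F] u(1)] Fc[OF u(1)] by simp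
    finally show ?thesis using u by (simp add: add zero)
  qed
  show "x \<oplus>\<^bsub>?M\<^esub> y = y \<oplus>\<^bsub>?M\<^esub> x" if xy: "x \<in> carrier ?M" "y \<in> carrier ?M" for x y
  proof -
    obtain u v where u: "u \<in> F n" "v \<in> F n" "x = ?K +> u" "y = ?K +> v"
      using xy by (auto simp: carr)
    then show ?thesis using Fc by (simp add: add sum a_comm)
  qed
qed

lemma finsum_gr_comp:
  assumes F: "ideal (F n) R" and F': "ideal (F (Suc n)) R"
    and "finite A" and "\<And>i. i \<in> A \<Longrightarrow> z i \<in> F n"
  shows "(\<Oplus>i\<in>A. z i) \<in> F n \<and>
    (\<Oplus>\<^bsub>gr_comp R F n\<^esub>i\<in>A. F (Suc n) +> z i) = F (Suc n) +> (\<Oplus>i\<in>A. z i)"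
  using assms(3,4)
proof (induct A rule: finite_induct)
  interpret M: abelian_monoid "gr_comp R F n" by (rule gr_comp_abelian_monoid[where F = F, OF F F'])
  {
    case empty
    then show ?case
      using a_rcos_zero[OF F' ideal_zero[OF F']] ideal_zero[OF F]
      by (simp add: gr_comp_simps)
  next
    case (insert i A)
    have c: "(\<lambda>i. F (Suc n) +> z i) \<in> A \<rightarrow> carrier (gr_comp R F n)" "F (Suc n) +> z i \<in> carrier (gr_comp R F n)"
      using insert by (auto simp: gr_comp_simps)
    have zc: "z \<in> A \<rightarrow> carrier R" "z i \<in> carrier R" using insert ideal.Icarr[OF F] by auto
    have IH: "(\<Oplus>i\<in>A. z i) \<in> F n"
      "(\<Oplus>\<^bsub>gr_comp R F n\<^esub>i\<in>A. F (Suc n) +> z i) = F (Suc n) +> (\<Oplus>i\<in>A. z i)"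
      using insert by auto
    have "(\<Oplus>\<^bsub>gr_comp R F n\<^esub>i\<in>insert i A. F (Suc n) +> z i)
        = (F (Suc n) +> z i) <+>\<^bsub>R\<^esub> (F (Suc n) +> (\<Oplus>i\<in>A. z i))"
      using M.finsum_insert[OF insert(1,2) c] IH(2) by (simp add: gr_comp_simps)
    also have "\<dots> = F (Suc n) +> (z i \<oplus> (\<Oplus>i\<in>A. z i))"
      using zc ideal.Icarr[OF F IH(1)] by (intro ideal.a_rcos_sum[OF F'])
    also have "z i \<oplus> (\<Oplus>i\<in>A. z i) = (\<Oplus>i\<in>insert i A. z i)"
      using finsum_insert[OF insert(1,2) zc] by simp
    finally show ?case using finsum_insert[OF insert(1,2) zc] IH(1) insert ideal_add[OF F] by simp
  }
qed

text \<open>The factors are cosets of different ideals \<open>A\<close> and \<open>B\<close>, so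
  independence of representatives modulo \<open>K\<close> rests on the three product
  conditions.\<close>

lemma rcoset_mult_rcos:
  assumes A: "ideal A R" and B: "ideal B R" and K: "ideal K R" and x: "x \<in> carrier R" and y: "y \<in> carrier R"
    and xB: "\<And>b. b \<in> B \<Longrightarrow> x \<otimes> b \<in> K" and Ay: "\<And>a. a \<in> A \<Longrightarrow> a \<otimes> y \<in> K"
    and AB: "\<And>a b. \<lbrakk>a \<in> A; b \<in> B\<rbrakk> \<Longrightarrow> a \<otimes> b \<in> K"
  shows "rcoset_mult R K (A +> x) (B +> y) = K +> (x \<otimes> y)"
proof -
  have "K +> (u \<otimes> v) = K +> (x \<otimes> y)" if u: "u \<in> A +> x" and v: "v \<in> B +> y" for u v
  proof (rule rcos_eqI[OF K])
    note u' = rcos_diff[OF A x u] and v' = rcos_diff[OF B y v]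
    have "u \<otimes> v \<ominus> x \<otimes> y = ((u \<ominus> x) \<otimes> (v \<ominus> y) \<oplus> (u \<ominus> x) \<otimes> y) \<oplus> x \<otimes> (v \<ominus> y)"
      using u'(1) v'(1) x y by algebra
    then show "u \<otimes> v \<ominus> x \<otimes> y \<in> K" using xB[OF v'(2)] Ay[OF u'(2)] AB[OF u'(2) v'(2)] ideal_add[OF K] by simp
  qed (use rcos_diff[OF A x u] rcos_diff[OF B y v] x y in auto)
  moreover have "x \<in> A +> x" "y \<in> B +> y" using rcos_rep_mem A B x y by auto
  ultimately show ?thesis unfolding rcoset_mult_def by blast
qed

section \<open>The graded ring of \<open>R / I\<close>, computed with representatives in the powers
  of \<open>J\<close>\<close>

abbreviation gr_filtration :: "'a set \<Rightarrow> nat \<Rightarrow> 'a set" where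
  "gr_filtration I \<equiv> adic_filtration R J I"

lemma gr_filtration_ideal: "ideal I R \<Longrightarrow> ideal (gr_filtration I n) R"
  unfolding adic_filtration_def by (intro add_ideals P_ideal)

lemma P_subset_gr_filtration: "ideal I R \<Longrightarrow> P n \<subseteq> gr_filtration I n"
  unfolding adic_filtration_def by (rule subset_set_add1[OF P_ideal])

lemma gr_filtration_mult:
  assumes I: "ideal I R" and x: "x \<in> P m" and y: "y \<in> gr_filtration I n" and k: "k \<le> m + n"
  shows "x \<otimes> y \<in> gr_filtration I k"
proof -
  obtain p i where pi: "p \<in> P n" "i \<in> I" "y = p \<oplus> i" using y by (auto simp: adic_filtration_def set_add_mem_iff)
  have carr: "x \<in> carrier R" "p \<in> carrier R" "i \<in> carrier R"
    using P_carr x pi ideal.Icarr[OF I] by auto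
  have "x \<otimes> y = x \<otimes> p \<oplus> x \<otimes> i" unfolding pi(3) using carr by algebra
  moreover have "x \<otimes> p \<in> P k" by (rule P_mult[OF x pi(1) k])
  moreover have "x \<otimes> i \<in> I" by (rule ideal_lmult[OF I pi(2) carr(1)])
  ultimately show ?thesis by (auto simp: adic_filtration_def set_add_mem_iff)
qed

lemma gr_filtration_mult2:
  assumes I: "ideal I R" and x: "x \<in> gr_filtration I m" and y: "y \<in> gr_filtration I n" and k: "k \<le> m + n"
  shows "x \<otimes> y \<in> gr_filtration I k"
proof -
  obtain p i where pi: "p \<in> P m" "i \<in> I" "x = p \<oplus> i" using x by (auto simp: adic_filtration_def set_add_mem_iff)
  have carr: "y \<in> carrier R" "p \<in> carrier R" "i \<in> carrier R"
    using P_carr pi ideal.Icarr[OF I] ideal.Icarr[OF gr_filtration_ideal[OF I] y] by auto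
  have "x \<otimes> y = p \<otimes> y \<oplus> i \<otimes> y" unfolding pi(3) using carr by algebra
  moreover have "p \<otimes> y \<in> gr_filtration I k" by (rule gr_filtration_mult[OF I pi(1) y k])
  moreover have "i \<otimes> y \<in> gr_filtration I k"
    using ideal_rmult[OF I pi(2) carr(1)] subset_set_add2[OF P_ideal I] unfolding adic_filtration_def by blast
  ultimately show ?thesis using ideal_add[OF gr_filtration_ideal[OF I]] by simp
qed

text \<open>In \<open>P n + I\<close> the summand from \<open>I\<close> lies in the next filtration
  step. So each component is a quotient of \<open>P n\<close>, whatever \<open>I\<close> is, and two
  such rings can be compared by representatives.\<close>

lemma gr_rep:
  assumes I: "ideal I R" and C: "C \<in> carrier (gr_comp R (gr_filtration I) n)"
  shows "\<exists>x\<in>P n. C = gr_filtration I (Suc n) +> x"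
proof -
  obtain y where y: "y \<in> gr_filtration I n" "C = gr_filtration I (Suc n) +> y"
    using C by (auto simp: gr_comp_simps)
  obtain p i where pi: "p \<in> P n" "i \<in> I" "y = p \<oplus> i" using y by (auto simp: adic_filtration_def set_add_mem_iff)
  have carr: "p \<in> carrier R" "i \<in> carrier R" using P_carr[OF pi(1)] ideal.Icarr[OF I pi(2)] .
  have "p \<oplus> i \<ominus> p = i" using carr by algebra
  then have "gr_filtration I (Suc n) +> y = gr_filtration I (Suc n) +> p"
    unfolding pi(3) using carr pi(2) subset_set_add2[OF P_ideal I, of "Suc n"]
    by (intro rcos_eqI gr_filtration_ideal I) (auto simp: adic_filtration_def)
  then show ?thesis using y pi by blast
qed

lemma gr_carrier_iff:
  assumes I: "ideal I R"
  shows "s \<in> carrier (gr_ring R (gr_filtration I)) \<longleftrightarrow>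
    (\<exists>x. (\<forall>n. x n \<in> P n) \<and> s = (\<lambda>n. gr_filtration I (Suc n) +> x n)) \<and>
    finite {n. s n \<noteq> gr_filtration I (Suc n)}"
    (is "?l \<longleftrightarrow> ?r")
proof -
  have "C \<in> carrier (gr_comp R (gr_filtration I) n) \<longleftrightarrow> (\<exists>x. x \<in> P n \<and> C = gr_filtration I (Suc n) +> x)"
    for n C
    using gr_rep[OF I, of C n] subsetD[OF P_subset_gr_filtration[OF I]] by (auto simp: gr_comp_simps)
  then have "(\<forall>n. s n \<in> carrier (gr_comp R (gr_filtration I) n)) \<longleftrightarrow>
      (\<exists>x. \<forall>n. x n \<in> P n \<and> s n = gr_filtration I (Suc n) +> x n)"
    by (simp only: choice_iff)
  also have "\<dots> \<longleftrightarrow> (\<exists>x. (\<forall>n. x n \<in> P n) \<and> s = (\<lambda>n. gr_filtration I (Suc n) +> x n))"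
    by (simp add: fun_eq_iff all_conj_distrib)
  finally show ?thesis by (simp add: gr_ring_def direct_sum_def gr_comp_simps(3))
qed

lemma gr_mult:
  assumes I: "ideal I R" and x: "\<And>n. x n \<in> P n" and y: "\<And>n. y n \<in> P n"
  shows "(\<lambda>n. gr_filtration I (Suc n) +> x n) \<otimes>\<^bsub>gr_ring R (gr_filtration I)\<^esub> (\<lambda>n. gr_filtration I (Suc n) +> y n)
    = (\<lambda>n. gr_filtration I (Suc n) +> (\<Oplus>i\<in>{..n}. x i \<otimes> y (n - i)))"
proof -
  let ?F = "gr_filtration I"
  note F = gr_filtration_ideal[OF I] and PF = subsetD[OF P_subset_gr_filtration[OF I]]
  have "rcoset_mult R (?F (Suc n)) (?F (Suc i) +> x i) (?F (Suc (n - i)) +> y (n - i))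
      = ?F (Suc n) +> (x i \<otimes> y (n - i))" if "i \<le> n" for i n
  proof (rule rcoset_mult_rcos[OF F F F P_carr[OF x] P_carr[OF y]])
    show "x i \<otimes> b \<in> ?F (Suc n)" if "b \<in> ?F (Suc (n - i))" for b
      using \<open>i \<le> n\<close> by (intro gr_filtration_mult2[OF I PF[OF x] that]) simp
    show "c \<otimes> y (n - i) \<in> ?F (Suc n)" if "c \<in> ?F (Suc i)" for c
      using \<open>i \<le> n\<close> by (intro gr_filtration_mult2[OF I that PF[OF y]]) simp
    show "c \<otimes> b \<in> ?F (Suc n)" if "c \<in> ?F (Suc i)" "b \<in> ?F (Suc (n - i))" for c b
      using \<open>i \<le> n\<close> by (intro gr_filtration_mult2[OF I that]) simp
  qed
  then have "(\<Oplus>\<^bsub>gr_comp R ?F n\<^esub>i\<in>{..n}. rcoset_mult R (?F (Suc n)) (?F (Suc i) +> x i) (?F (Suc (n - i)) +> y (n - i)))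
     = (\<Oplus>\<^bsub>gr_comp R ?F n\<^esub>i\<in>{..n}. ?F (Suc n) +> (x i \<otimes> y (n - i)))" for n
    using PF[OF P_mult[OF x y]]
    by (intro abelian_monoid.finsum_cong'[OF gr_comp_abelian_monoid[where F = ?F, OF F F] refl])
      (auto simp: gr_comp_simps)
  moreover have "(\<Oplus>\<^bsub>gr_comp R ?F n\<^esub>i\<in>{..n}. ?F (Suc n) +> (x i \<otimes> y (n - i)))
      = ?F (Suc n) +> (\<Oplus>i\<in>{..n}. x i \<otimes> y (n - i))" for n
  proof -
    have "x i \<otimes> y (n - i) \<in> ?F n" if "i \<in> {..n}" for i using PF[OF P_mult[OF x y]] that by simp
    then show ?thesis by (intro conjunct2[OF finsum_gr_comp[where F = ?F, OF F F]]) auto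
  qed
  ultimately show ?thesis by (simp add: gr_ring_def)
qed

lemma gr_add:
  assumes I: "ideal I R" and x: "\<And>n. x n \<in> P n" and y: "\<And>n. y n \<in> P n"
  shows "(\<lambda>n. gr_filtration I (Suc n) +> x n) \<oplus>\<^bsub>gr_ring R (gr_filtration I)\<^esub> (\<lambda>n. gr_filtration I (Suc n) +> y n)
    = (\<lambda>n. gr_filtration I (Suc n) +> (x n \<oplus> y n))"
  using ideal.a_rcos_sum[OF gr_filtration_ideal[OF I] P_carr[OF x] P_carr[OF y]]
  by (simp add: gr_ring_def)

lemma gr_one:
  assumes I: "ideal I R"
  shows "\<one>\<^bsub>gr_ring R (gr_filtration I)\<^esub> =
    (\<lambda>n. gr_filtration I (Suc n) +> (if n = 0 then \<one> else \<zero>))"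
  using a_rcos_zero[OF gr_filtration_ideal[OF I] ideal_zero[OF gr_filtration_ideal[OF I]]]
  by (auto simp: gr_ring_def fun_eq_iff)

text \<open>In degree \<open>n\<close> both rings are quotients of \<open>P n\<close>, and the
  hypothesis says that the kernels agree. Keeping representatives is therefore well defined and
  injective, and it respects the graded operations.\<close>

lemma gr_isomorphic_of_same_trace:
  assumes I: "ideal I R" and I': "ideal I' R"
    and eq: "\<And>n. P n \<inter> gr_filtration I (Suc n) = P n \<inter> gr_filtration I' (Suc n)"
  shows "gr_isomorphic R (gr_filtration I) (gr_filtration I')"
proof -
  let ?F = "gr_filtration I" and ?G = "gr_filtration I'"
  let ?A = "gr_ring R ?F" and ?B = "gr_ring R ?G"
  \<comment> \<open>Any representative in \<open>P n\<close> may be chosen; \<open>FG\<close> shows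
    that the class over \<open>I'\<close> does not depend on the choice.\<close>
  define h where "h s = (\<lambda>n. ?G (Suc n) +> (SOME x. x \<in> P n \<and> s n = ?F (Suc n) +> x))" for s
  note F = gr_filtration_ideal[OF I] and G = gr_filtration_ideal[OF I']
  have FG: "?F (Suc n) +> x = ?F (Suc n) +> y \<longleftrightarrow> ?G (Suc n) +> x = ?G (Suc n) +> y"
    if "x \<in> P n" "y \<in> P n" for x y n
  proof -
    have "x \<ominus> y \<in> P n" using that ideal_diff[OF P_ideal] by blast
    then have "x \<ominus> y \<in> ?F (Suc n) \<longleftrightarrow> x \<ominus> y \<in> ?G (Suc n)" using eq by blast
    then show ?thesis
      using quotient_eq_iff_same_a_r_cos[OF F P_carr[OF that(1)] P_carr[OF that(2)]]
        quotient_eq_iff_same_a_r_cos[OF G P_carr[OF that(1)] P_carr[OF that(2)]] by blast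
  qed
  have h: "h (\<lambda>n. ?F (Suc n) +> x n) = (\<lambda>n. ?G (Suc n) +> x n)" if x: "\<And>n. x n \<in> P n" for x
  proof
    fix n
    have "\<exists>y. y \<in> P n \<and> ?F (Suc n) +> x n = ?F (Suc n) +> y" using x by blast
    note y = someI_ex[OF this]
    then show "h (\<lambda>n. ?F (Suc n) +> x n) n = ?G (Suc n) +> x n"
      unfolding h_def FG[OF x conjunct1[OF y]] by simp
  qed
  have zero: "?F (Suc n) +> x = ?F (Suc n) \<longleftrightarrow> ?G (Suc n) +> x = ?G (Suc n)" if "x \<in> P n" for x n
    using FG[OF that ideal_zero[OF P_ideal]] a_rcos_zero[OF F ideal_zero[OF F]] a_rcos_zero[OF G ideal_zero[OF G]]
    by simp
  have carr: "(\<lambda>n. ?F (Suc n) +> x n) \<in> carrier ?A \<longleftrightarrow> (\<lambda>n. ?G (Suc n) +> x n) \<in> carrier ?B"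
    if x: "\<And>n. x n \<in> P n" for x
  proof -
    have "{n. ?F (Suc n) +> x n \<noteq> ?F (Suc n)} = {n. ?G (Suc n) +> x n \<noteq> ?G (Suc n)}"
      using zero x by blast
    then show ?thesis unfolding gr_carrier_iff[OF I] gr_carrier_iff[OF I'] using x by auto
  qed
  have repF: "\<exists>x. (\<forall>n. x n \<in> P n) \<and> s = (\<lambda>n. ?F (Suc n) +> x n)" if "s \<in> carrier ?A" for s
    using that gr_carrier_iff[OF I] by blast
  have repG: "\<exists>x. (\<forall>n. x n \<in> P n) \<and> s = (\<lambda>n. ?G (Suc n) +> x n)" if "s \<in> carrier ?B" for s
    using that gr_carrier_iff[OF I'] by blast
  have hom: "h \<in> ring_hom ?A ?B"
  proof (rule ring_hom_memI)
    fix s assume s: "s \<in> carrier ?A"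
    then obtain x where x: "\<And>n. x n \<in> P n" "s = (\<lambda>n. ?F (Suc n) +> x n)" using repF by blast
    then show "h s \<in> carrier ?B" using s carr[OF x(1)] h[OF x(1)] by simp
    fix t assume "t \<in> carrier ?A"
    then obtain y where y: "\<And>n. y n \<in> P n" "t = (\<lambda>n. ?F (Suc n) +> y n)" using repF by blast
    have "x i \<otimes> y (n - i) \<in> P n" if "i \<le> n" for i n using P_mult[OF x(1) y(1)] that by simp
    then have "(\<Oplus>i\<in>{..n}. x i \<otimes> y (n - i)) \<in> P n" for n
      using finsum_gr_comp[of P n "{..n}" "\<lambda>i. x i \<otimes> y (n - i)"] P_ideal by simp
    then show "h (s \<otimes>\<^bsub>?A\<^esub> t) = h s \<otimes>\<^bsub>?B\<^esub> h t"
      using x y by (simp add: gr_mult[OF I] gr_mult[OF I'] h)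
    have "x n \<oplus> y n \<in> P n" for n using x y ideal_add[OF P_ideal] by blast
    then show "h (s \<oplus>\<^bsub>?A\<^esub> t) = h s \<oplus>\<^bsub>?B\<^esub> h t"
      using x y by (simp add: gr_add[OF I] gr_add[OF I'] h)
  next
    have "(if n = 0 then \<one> else \<zero>) \<in> P n" for n
      using ideal_zero[OF P_ideal] by (auto simp: ideal_pow_0)
    then show "h \<one>\<^bsub>?A\<^esub> = \<one>\<^bsub>?B\<^esub>" unfolding gr_one[OF I] gr_one[OF I'] by (rule h)
  qed
  have bij: "bij_betw h (carrier ?A) (carrier ?B)"
    unfolding bij_betw_def
  proof
    show "inj_on h (carrier ?A)"
    proof (rule inj_onI)
      fix s t assume s: "s \<in> carrier ?A" and t: "t \<in> carrier ?A" and st: "h s = h t"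
      obtain x where x: "\<And>n. x n \<in> P n" "s = (\<lambda>n. ?F (Suc n) +> x n)" using repF[OF s] by blast
      obtain y where y: "\<And>n. y n \<in> P n" "t = (\<lambda>n. ?F (Suc n) +> y n)" using repF[OF t] by blast
      have "(\<lambda>n. ?G (Suc n) +> x n) = (\<lambda>n. ?G (Suc n) +> y n)"
        using st unfolding x(2) y(2) h[OF x(1)] h[OF y(1)] .
      then have "?G (Suc n) +> x n = ?G (Suc n) +> y n" for n by (rule fun_cong)
      then show "s = t" unfolding x(2) y(2) using FG[OF x(1) y(1)] by simp
    qed
    have "t \<in> h ` carrier ?A" if t: "t \<in> carrier ?B" for t
    proof -
      obtain x where x: "\<And>n. x n \<in> P n" "t = (\<lambda>n. ?G (Suc n) +> x n)" using repG[OF t] by blast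
      have "(\<lambda>n. ?F (Suc n) +> x n) \<in> carrier ?A" using t carr[OF x(1)] unfolding x(2) by (rule iffD2[rotated])
      then have "h (\<lambda>n. ?F (Suc n) +> x n) \<in> h ` carrier ?A" by (rule imageI)
      then show ?thesis unfolding x(2) h[OF x(1)] .
    qed
    then show "h ` carrier ?A = carrier ?B" using ring_hom_closed[OF hom] by (intro equalityI subsetI) auto
  qed
  have degree: "h s m = ?G (Suc m) \<longleftrightarrow> s m = ?F (Suc m)" if s: "s \<in> carrier ?A" for s m
  proof -
    obtain x where x: "\<And>n. x n \<in> P n" "s = (\<lambda>n. ?F (Suc n) +> x n)" using repF[OF s] by blast
    show ?thesis unfolding x(2) h[OF x(1)] by (rule zero[OF x(1), symmetric])
  qed
  have surj: "h ` carrier ?A = carrier ?B" using bij by (rule bij_betw_imp_surj_on)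
  have "h s \<in> gr_homogeneous R ?G n \<longleftrightarrow> s \<in> gr_homogeneous R ?F n" if s: "s \<in> carrier ?A" for s n
    using s surj unfolding gr_homogeneous_def mem_Collect_eq degree[OF s] by auto
  moreover have "gr_homogeneous R ?F n \<subseteq> carrier ?A" "gr_homogeneous R ?G n \<subseteq> h ` carrier ?A" for n
    unfolding surj by (auto simp: gr_homogeneous_def)
  ultimately have "h ` gr_homogeneous R ?F n = gr_homogeneous R ?G n" for n by blast
  then show ?thesis unfolding gr_isomorphic_def ring_iso_def using hom bij by blast
qed

section \<open>Consequences of equal initial ideals\<close>

lemma initial_le_gr_filtration:
  assumes I: "ideal I R" and I': "ideal I' R" and le: "initial_le I I'"
  shows "P n \<inter> gr_filtration I (Suc n) \<subseteq> gr_filtration I' (Suc n)"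
proof
  fix x assume x: "x \<in> P n \<inter> gr_filtration I (Suc n)"
  then obtain p i where pi: "p \<in> P (Suc n)" "i \<in> I" "x = p \<oplus> i"
    by (auto simp: adic_filtration_def set_add_mem_iff)
  have carr: "p \<in> carrier R" "i \<in> carrier R" using P_carr[OF pi(1)] ideal.Icarr[OF I pi(2)] .
  then have "i = x \<ominus> p" unfolding pi(3) by algebra
  moreover have "p \<in> P n" using pi(1) P_antimono[of n "Suc n"] by auto
  \<comment> \<open>The modular law:
    \<open>P n \<inter> (P (Suc n) + I) = P (Suc n) + (P n \<inter> I)\<close>, which makes the
    hypothesis on initial forms applicable to \<open>i\<close>.\<close>
  ultimately have "i \<in> P n" using x ideal_diff[OF P_ideal] by blast
  then obtain i' where i': "i' \<in> I'" "i \<ominus> i' \<in> P (Suc n)" using le pi(2) unfolding initial_le_def by blast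
  have "x = (p \<oplus> (i \<ominus> i')) \<oplus> i'" unfolding pi(3) using carr ideal.Icarr[OF I' i'(1)] by algebra
  then show "x \<in> gr_filtration I' (Suc n)"
    using i' ideal_add[OF P_ideal pi(1) i'(2)] by (auto simp: adic_filtration_def set_add_mem_iff)
qed

lemma gr_isomorphic_of_initial_le:
  assumes "ideal I R" "ideal I' R" "initial_le I I'" "initial_le I' I"
  shows "gr_isomorphic R (gr_filtration I) (gr_filtration I')"
  using assms initial_le_gr_filtration by (intro gr_isomorphic_of_same_trace) blast+

lemma initial_le_subset:
  assumes I: "ideal I R" and I': "ideal I' R" and le: "initial_le I I'"
  shows "(I \<inter> P n) <+>\<^bsub>R\<^esub> P (Suc n) \<subseteq> (I' \<inter> P n) <+>\<^bsub>R\<^esub> P (Suc n)"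
proof
  fix x assume "x \<in> (I \<inter> P n) <+>\<^bsub>R\<^esub> P (Suc n)"
  then obtain i p where pi: "i \<in> I" "i \<in> P n" "p \<in> P (Suc n)" "x = i \<oplus> p" by (auto simp: set_add_mem_iff)
  obtain i' where i': "i' \<in> I'" "i' \<in> P n" "i \<ominus> i' \<in> P (Suc n)"
    using initial_le_mem[OF le pi(2,1) I'] by blast
  have "x = i' \<oplus> ((i \<ominus> i') \<oplus> p)"
    unfolding pi(4) using P_carr[OF pi(2)] P_carr[OF pi(3)] P_carr[OF i'(2)] by algebra
  then show "x \<in> (I' \<inter> P n) <+>\<^bsub>R\<^esub> P (Suc n)"
    using i' ideal_add[OF P_ideal i'(3) pi(3)] by (auto simp: set_add_mem_iff)
qed

lemma initial_ideal_cong: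
  assumes "ideal I R" "ideal I' R" "initial_le I I'" "initial_le I' I"
  shows "initial_ideal R J I = initial_ideal R J I'"
proof -
  have "(I \<inter> P n) <+>\<^bsub>R\<^esub> P (Suc n) = (I' \<inter> P n) <+>\<^bsub>R\<^esub> P (Suc n)" for n
    using assms initial_le_subset by blast
  then show ?thesis by (simp add: initial_ideal_def)
qed

lemma artin_rees_number_cong:
  assumes "ideal I R" "ideal I' R" "initial_le I I'" "initial_le I' I"
  shows "artin_rees_number R J I = artin_rees_number R J I'"
proof -
  have "artin_rees_exact I c \<longleftrightarrow> artin_rees_exact I' c" for c
    using assms initial_le_artin_rees_exact by blast
  then show ?thesis by (simp add: artin_rees_number_eq)
qed

end

section \<open>Noetherian local rings and the perturbation theorem\<close>

lemma (in noetherian_ring) proper_ideal_in_maximal: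
  assumes I: "ideal I R" "I \<noteq> carrier R"
  shows "\<exists>M. maximalideal M R \<and> I \<subseteq> M"
proof -
  define F where "F = {K. ideal K R \<and> I \<subseteq> K \<and> K \<noteq> carrier R}"
  have "\<exists>M\<in>F. \<forall>D\<in>F. M \<subseteq> D \<longrightarrow> D = M"
  proof (rule subset_Zorn_nonempty)
    show "F \<noteq> {}" using I by (auto simp: F_def)
    fix Ch assume Ch: "Ch \<noteq> {}" "subset.chain F Ch"
    then have "subset.chain {I. ideal I R} Ch" by (auto simp: pred_on.chain_def F_def)
    then have "\<Union>Ch \<in> Ch" by (rule ideal_chain_is_trivial[OF Ch(1)])
    then show "\<Union>Ch \<in> F" using Ch(2) by (auto simp: pred_on.chain_def)
  qed
  then obtain M where M: "M \<in> F" and max: "\<And>D. \<lbrakk>D \<in> F; M \<subseteq> D\<rbrakk> \<Longrightarrow> D = M" by blast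
  have M': "ideal M R" "I \<subseteq> M" "carrier R \<noteq> M" using M by (auto simp: F_def)
  have "D = M \<or> D = carrier R" if "ideal D R" "M \<subseteq> D" for D
    using max[of D] that M'(2) by (auto simp: F_def)
  then have "maximalideal M R" by (intro maximalidealI M')
  then show ?thesis using M'(2) by blast
qed

text \<open>A nonunit \<open>1 - j\<close> would lie in a maximal ideal. The only one contains the
  proper ideal \<open>J\<close>, hence both \<open>j\<close> and 1.\<close>

lemma radical_adic_of_local:
  assumes R: "noetherian_local_ring R" and J: "ideal J R" "J \<noteq> carrier R"
  shows "radical_adic R J"
proof -
  interpret noetherian_local_ring R by (rule R)
  have unit: "\<one>\<^bsub>R\<^esub> \<ominus>\<^bsub>R\<^esub> j \<in> Units R" if j: "j \<in> J" for j
  proof (rule ccontr)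
    assume nu: "\<one>\<^bsub>R\<^esub> \<ominus>\<^bsub>R\<^esub> j \<notin> Units R"
    have jc: "j \<in> carrier R" by (rule ideal.Icarr[OF J(1) j])
    let ?u = "\<one>\<^bsub>R\<^esub> \<ominus>\<^bsub>R\<^esub> j"
    have u: "?u \<in> carrier R" using jc by simp
    have "\<one>\<^bsub>R\<^esub> \<notin> PIdl\<^bsub>R\<^esub> ?u"
      using nu u unfolding cgenideal_def Units_def by (auto simp: m_comm)
    then have "PIdl\<^bsub>R\<^esub> ?u \<noteq> carrier R" by auto
    then obtain M where M: "maximalideal M R" "PIdl\<^bsub>R\<^esub> ?u \<subseteq> M"
      using proper_ideal_in_maximal[OF cgenideal_ideal[OF u]] by blast
    obtain M' where M': "maximalideal M' R" "J \<subseteq> M'" using proper_ideal_in_maximal[OF J] by blast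
    have "M' = M" using unique_maximal M(1) M'(1) by blast
    then have "j \<in> M" "?u \<in> M" using M M' j cgenideal_self[OF u] by auto
    moreover have "?u \<oplus>\<^bsub>R\<^esub> j = \<one>\<^bsub>R\<^esub>" using jc by algebra
    ultimately have "\<one>\<^bsub>R\<^esub> \<in> M" using ideal_add[OF maximalideal.axioms(1)[OF M(1)]] by metis
    then have "M = carrier R" by (rule ideal.one_imp_carrier[OF maximalideal.axioms(1)[OF M(1)]])
    then show False using maximalideal.I_notcarr[OF M(1)] by simp
  qed
  show ?thesis
    by (intro radical_adic.intro noetherian_cring.intro radical_adic_axioms.intro J unit)
      (unfold_locales)
qed

lemma Max_insert_enat:
  fixes s r :: nat and \<beta> :: "nat \<Rightarrow> nat"
  shows "Max (insert (enat s) ((\<lambda>i. enat (\<beta> i)) ` {1..r})) = enat (Max (insert s (\<beta> ` {1..r})))"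
proof -
  have "mono enat" by (simp add: mono_def)
  then have "enat (Max (insert s (\<beta> ` {1..r}))) = Max (enat ` insert s (\<beta> ` {1..r}))"
    by (intro mono_Max_commute) auto
  then show ?thesis by (simp add: image_image)
qed

theorem theorem1p1:
  fixes R :: "('a, 'b) ring_scheme"
    and J I I' :: "'a set"
    and f f' \<epsilon> :: "nat \<Rightarrow> 'a"
    and r N :: nat
    and a A :: "nat \<Rightarrow> enat"
  assumes "noetherian_local_ring R"
    and "ideal J R"
    and "J \<noteq> carrier R"
    and "filter_regular R J f r"
    and "I = seq_ideal R f r"
    and "\<And>i. a i = loewy_length R J (colon_quot R f i)"
    and "\<And>i. A i = artin_rees_number R J (seq_ideal R f i)"
    and "N = the_enat (Max (insert (\<Sum>i=1..r. 2 ^ (i - 2) * a i) (A ` {1..r})) + 1)"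
    and "\<And>i. i \<in> {1..r} \<Longrightarrow> \<epsilon> i \<in> ideal_pow R J N"
    and "\<And>i. f' i = f i \<oplus>\<^bsub>R\<^esub> \<epsilon> i"
    and "I' = seq_ideal R f' r"
  shows "(filter_regular R J f' r \<and>
       (\<forall>i\<in>{1..r}. loewy_length R J (colon_quot R f' i) \<le> 2 ^ (i - 1) * a i)) \<and>
     (\<forall>j\<in>{1..r}. initial_ideal R J (seq_ideal R f' j) = initial_ideal R J (seq_ideal R f j)) \<and>
     (gr_isomorphic R (adic_filtration R J I') (adic_filtration R J I) \<and>
       artin_rees_number R J I' = artin_rees_number R J I)"
proof -
  interpret radical_adic R J by (rule radical_adic_of_local[OF assms(1-3)])
  have f: "f i \<in> carrier R"
    and kill_ex: "\<exists>n. P n \<cdot>\<^bsub>R\<^esub> colon R (seq_ideal R f (i - 1)) (f i) \<subseteq> seq_ideal R f (i - 1)"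
    if "i \<in> {1..r}" for i
    using assms(4) that unfolding filter_regular_iff by blast+
  have fS: "ideal (seq_ideal R f j) R" if "j \<le> r" for j using f that by (intro seq_ideal_ideal) auto
  have f': "f' i \<in> carrier R" if "i \<in> {1..r}" for i
    using f[OF that] P_carr[OF assms(9)[OF that]] by (simp add: assms(10))
  have fS': "ideal (seq_ideal R f' j) R" if "j \<le> r" for j using f' that by (intro seq_ideal_ideal) auto
  have "\<exists>n. a i = enat n \<and> P n \<cdot>\<^bsub>R\<^esub> colon R (seq_ideal R f (i - 1)) (f i) \<subseteq> seq_ideal R f (i - 1)"
    if i: "i \<in> {1..r}" for i
  proof -
    have K: "ideal (seq_ideal R f (i - 1)) R" using i by (intro fS) auto
    obtain n where n: "loewy_length R J (colon_quot R f i) = enat n"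
      "P n \<cdot>\<^bsub>R\<^esub> colon R (seq_ideal R f (i - 1)) (f i) \<subseteq> seq_ideal R f (i - 1)"
      unfolding colon_quot_def
      by (rule loewy_length_subquot_attained[OF colon_ideal[OF K f[OF i]] K kill_ex[OF i]])
    show ?thesis unfolding assms(6) by (rule exI[of _ n], rule conjI[OF n])
  qed
  then obtain \<alpha> where \<alpha>: "\<And>i. i \<in> {1..r} \<Longrightarrow> a i = enat (\<alpha> i)"
    and kill: "\<And>i. i \<in> {1..r} \<Longrightarrow>
      P (\<alpha> i) \<cdot>\<^bsub>R\<^esub> colon R (seq_ideal R f (i - 1)) (f i) \<subseteq> seq_ideal R f (i - 1)" by metis
  have "\<exists>c. A j = enat c \<and> artin_rees_exact (seq_ideal R f j) c" if j: "j \<in> {1..r}" for j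
  proof -
    have K: "ideal (seq_ideal R f j) R" using j by (intro fS) auto
    obtain c where c: "artin_rees_number R J (seq_ideal R f j) = enat c"
      "artin_rees_exact (seq_ideal R f j) c" by (rule artin_rees_number_attained[OF K])
    show ?thesis unfolding assms(7) by (rule exI[of _ c], rule conjI[OF c])
  qed
  then obtain \<beta> where \<beta>: "\<And>j. j \<in> {1..r} \<Longrightarrow> A j = enat (\<beta> j)"
    and exact: "\<And>j. j \<in> {1..r} \<Longrightarrow> artin_rees_exact (seq_ideal R f j) (\<beta> j)" by metis
  define s where "s = (\<Sum>i=1..r. 2 ^ (i - 2) * \<alpha> i)"
  define g where "g k i = (if i \<le> k then f i else f i \<oplus>\<^bsub>R\<^esub> \<epsilon> i)" for k :: nat and i
  have "(\<Sum>i=1..r. 2 ^ (i - 2) * a i) = enat s"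
    unfolding s_def of_nat_eq_enat[symmetric] by (simp add: \<alpha> of_nat_eq_enat[symmetric])
  moreover have "A ` {1..r} = (\<lambda>i. enat (\<beta> i)) ` {1..r}" using \<beta> by (rule image_cong[OF refl])
  \<comment> \<open>All lengths and Artin-Rees numbers are finite here, so \<open>the_enat\<close>
    is applied to a finite value.\<close>
  ultimately have N: "N = Suc (Max (insert s (\<beta> ` {1..r})))"
    using assms(8) Max_insert_enat[of s \<beta> r] by (simp add: one_enat_def)
  have "x < N" if "x \<in> insert s (\<beta> ` {1..r})" for x
    unfolding N by (intro le_imp_less_Suc Max_ge that) simp
  then have "s \<le> N" "\<And>j. j \<in> {1..r} \<Longrightarrow> \<beta> j < N" by (auto intro: less_imp_le)
  then have *: "(\<forall>i\<in>{1..r}. P (if 0 < i then 2 ^ (i - 0 - 1) * \<alpha> i else \<alpha> i)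
          \<cdot>\<^bsub>R\<^esub> colon R (seq_ideal R (g 0) (i - 1)) (g 0 i) \<subseteq> seq_ideal R (g 0) (i - 1)) \<and>
      (\<forall>j\<in>{1..r}. initial_le (seq_ideal R f j) (seq_ideal R (g 0) j) \<and>
        initial_le (seq_ideal R (g 0) j) (seq_ideal R f j))"
    unfolding g_def using f assms(9) kill exact by (intro perturb_all) (auto simp: s_def)
  have S: "seq_ideal R (g 0) j = seq_ideal R f' j" for j
    by (intro seq_ideal_cong) (auto simp: assms(10) g_def)
  have kill': "P (2 ^ (i - 1) * \<alpha> i) \<cdot>\<^bsub>R\<^esub> colon R (seq_ideal R f' (i - 1)) (f' i) \<subseteq> seq_ideal R f' (i - 1)"
    if "i \<in> {1..r}" for i
    using bspec[OF conjunct1[OF *] that] that unfolding S by (simp add: assms(10) g_def)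
  have le: "initial_le (seq_ideal R f j) (seq_ideal R f' j)" "initial_le (seq_ideal R f' j) (seq_ideal R f j)"
    if "j \<in> {1..r}" for j using bspec[OF conjunct2[OF *] that] unfolding S by auto
  \<comment> \<open>For \<open>r = 0\<close> the facts \<open>le\<close> are void, but both ideals
    are generated by the empty set.\<close>
  have le_r: "initial_le I I'" "initial_le I' I"
  proof -
    have "initial_le I I' \<and> initial_le I' I"
    proof (cases "r = 0")
      case True
      then have "I = I'" by (simp add: assms(5,11) seq_ideal_def)
      then show ?thesis using initial_le_refl[OF fS[of r]] by (simp add: assms(5))
    next
      case False
      then show ?thesis using le[of r] by (simp add: assms(5,11))
    qed
    then show "initial_le I I'" "initial_le I' I" by auto
  qed
  have I: "ideal I R" "ideal I' R" using fS fS' by (auto simp: assms(5,11))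
  have "filter_regular R J f' r" unfolding filter_regular_iff using f' kill' by blast
  moreover have "loewy_length R J (colon_quot R f' i) \<le> 2 ^ (i - 1) * a i" if i: "i \<in> {1..r}" for i
  proof -
    have K: "ideal (seq_ideal R f' (i - 1)) R" using i by (intro fS') auto
    have "loewy_length R J (colon_quot R f' i) \<le> enat (2 ^ (i - 1) * \<alpha> i)"
      unfolding colon_quot_def
      by (rule loewy_length_subquot_le[OF colon_ideal[OF K f'[OF i]] K kill'[OF i]])
    also have "\<dots> = 2 ^ (i - 1) * a i"
      unfolding \<alpha>[OF i] of_nat_eq_enat[symmetric] by simp
    finally show ?thesis .
  qed
  moreover have "initial_ideal R J (seq_ideal R f' j) = initial_ideal R J (seq_ideal R f j)"
    if j: "j \<in> {1..r}" for j
    using initial_ideal_cong[OF fS' fS le(2,1)[OF j]] j by simp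
  moreover have "gr_isomorphic R (adic_filtration R J I') (adic_filtration R J I)"
    by (rule gr_isomorphic_of_initial_le[OF I(2,1) le_r(2,1)])
  moreover have "artin_rees_number R J I' = artin_rees_number R J I"
    by (rule artin_rees_number_cong[OF I(2,1) le_r(2,1)])
  ultimately show ?thesis by blast
qed

end
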